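(* Let $h,j$ be combinatorial presheaves and $f:h\Rightarrow j$ a morphism of presheaves (a natural transformation). Then the linear map $\mathcal A[f]:\mathcal A(j)\to\mathcal A(h)$ defined by $\mathcal A[f](\mathrm{p}_a)=\sum_{b\in\mathcal G(h),\,f(b)=a}\mathrm{p}_b$ for $a\in\mathcal G(j)$ is an algebra morphism. Furthermore, if $(h,\ast_h,1_h)$ and $(j,\ast_j,1_j)$ are associative presheaves and $f$ is a morphism of associative presheaves, then $\mathcal A[f]$ is a bialgebra morphism; consequently, if $h$ and $j$ are moreover connected, $\mathcal A[f]$ is a Hopf algebra morphism.
   Context: A combinatorial presheaf $h$ is a contravariant functor from finite sets with injections to finite sets; $h[I]$ are objects on $I$, $a|_J$ restriction. $a\sim b$ if related by a relabeling bijection; $\mathcal G(h)=\biguplus_n h[[n]]/\sim$. A morphism $f:h\Rightarrow j$ is a family $f_I:h[I]\to j[I]$ commuting with all maps induced by injections; it induces a size-preserving map $\mathcal G(h)\to\mathcal G(j)$, also denoted $f$ (so the sum in the claim is finite). For $b\in h[I]$, $\mathrm{p}_a(b)=|\{J'\subseteq I:b|_{J'}\sim a\}|$; $\mathcal A(h)$ is the $\mathbb Q$-span of the $\mathrm{p}_a$ ($a\in\mathcal G(h)$) as functions $\mathcal G(h)\to\mathbb Q$ with pointwise product. An associative presheaf $(h,\ast,1)$ has natural products $h[I]\times h[J]\to h[I\sqcup J]$ for disjoint $I,J$ with $(a\ast b)|_{A\sqcup B}=a|_A\ast b|_B$, associative, unit $1\in h[\emptyset]$; connected if $|h[\emptyset]|=1$.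 It induces a product $\cdot$ on $\mathcal G(h)$, and $\mathcal A(h)$ is a bialgebra with $\Delta\mathrm{p}_a=\sum_{b\cdot c=a}\mathrm{p}_b\otimes\mathrm{p}_c$ and counit $\epsilon(\mathrm{p}_a)=[a=1]$ (a Hopf algebra when connected). A morphism of associative presheaves is a presheaf morphism $f$ with $f(1_h)=1_j$ and $f(b\ast_h c)=f(b)\ast_j f(c)$. *)

theory Defs
  imports Complex_Main "HOL-Library.FuncSet" "HOL-Library.Function_Algebras"
begin

section \<open>Combinatorial presheaves\<close>

text \<open>
  Label sets are the finite subsets of \<^typ>\<open>nat\<close>; they contain all the sets \<open>[n] = {1..n}\<close>
  and form a category equivalent to that of all finite sets with injections.
  For an injection \<open>\<phi>\<close> from \<open>I\<close> to \<open>J\<close>, \<open>act h I J \<phi>\<close> is the induced map from \<open>h[J]\<close> to \<open>h[I]\<close>.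
\<close>

definition injections :: "nat set \<Rightarrow> nat set \<Rightarrow> (nat \<Rightarrow> nat) set" where
  "injections I J = {\<phi>. \<phi> \<in> I \<rightarrow> J \<and> inj_on \<phi> I}"

record 'a presheaf =
  obj :: "nat set \<Rightarrow> 'a set"
  act :: "nat set \<Rightarrow> nat set \<Rightarrow> (nat \<Rightarrow> nat) \<Rightarrow> 'a \<Rightarrow> 'a"

text \<open>
  HOL functions are total, so an injection from \<open>I\<close> to \<open>J\<close> is a HOL function up to its values
  outside \<open>I\<close>; \<open>act_cong\<close> expresses that those values are irrelevant.
\<close>

locale combinatorial_presheaf =
  fixes h :: "'a presheaf"
  assumes finite_obj: "finite I \<Longrightarrow> finite (obj h I)"
    and act_closed:
      "\<lbrakk>finite I; finite J; \<phi> \<in> injections I J; a \<in> obj h J\<rbrakk> \<Longrightarrow> act h I J \<phi> a \<in> obj h I"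
    and act_cong:
      "\<lbrakk>finite I; finite J; \<phi> \<in> injections I J; \<And>i. i \<in> I \<Longrightarrow> \<phi> i = \<psi> i; a \<in> obj h J\<rbrakk>
        \<Longrightarrow> act h I J \<phi> a = act h I J \<psi> a"
    and act_id: "\<lbrakk>finite I; a \<in> obj h I\<rbrakk> \<Longrightarrow> act h I I id a = a"
    and act_comp:
      "\<lbrakk>finite I; finite J; finite K; \<phi> \<in> injections I J; \<psi> \<in> injections J K; a \<in> obj h K\<rbrakk>
        \<Longrightarrow> act h I K (\<psi> \<circ> \<phi>) a = act h I J \<phi> (act h J K \<psi> a)"

definition restr :: "'a presheaf \<Rightarrow> nat set \<Rightarrow> nat set \<Rightarrow> 'a \<Rightarrow> 'a" where
  "restr h I J a = act h J I id a"

text \<open>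
  An object is paired with its label set, since the sets \<open>h[I]\<close> need not be disjoint.
\<close>

definition iso_rel :: "'a presheaf \<Rightarrow> ((nat set \<times> 'a) \<times> (nat set \<times> 'a)) set" where
  "iso_rel h = {((I, a), (J, b)). finite I \<and> finite J \<and> a \<in> obj h I \<and> b \<in> obj h J \<and>
     (\<exists>\<phi>. bij_betw \<phi> I J \<and> act h I J \<phi> b = a)}"

text \<open>
  An element of \<open>\<G>(h)\<close> is the class of an object on some \<open>[n]\<close>. The class consists of all
  objects on finite subsets of \<^typ>\<open>nat\<close> related to it, not only of those on \<open>[n]\<close>; the latter
  are recovered by intersecting with \<open>h[[n]]\<close>.
\<close>

type_synonym 'a iso_class = "(nat set \<times> 'a) set"

definition iso_classes :: "'a presheaf \<Rightarrow> 'a iso_class set" ("\<G>") where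
  "\<G> h = (\<Union>n::nat. Pair {1..n} ` obj h {1..n}) // iso_rel h"

locale presheaf_morphism =
  fixes h :: "'a presheaf" and j :: "'b presheaf" and f :: "nat set \<Rightarrow> 'a \<Rightarrow> 'b"
  assumes mor_closed: "\<lbrakk>finite I; a \<in> obj h I\<rbrakk> \<Longrightarrow> f I a \<in> obj j I"
    and mor_natural:
      "\<lbrakk>finite I; finite J; \<phi> \<in> injections I J; a \<in> obj h J\<rbrakk>
        \<Longrightarrow> f I (act h I J \<phi> a) = act j I J \<phi> (f J a)"

text \<open>The induced map from \<open>\<G>(h)\<close> to \<open>\<G>(j)\<close>, sending the class of \<open>a\<close> to the class of \<open>f(a)\<close>.\<close>

definition class_map :: "'b presheaf \<Rightarrow> (nat set \<Rightarrow> 'a \<Rightarrow> 'b) \<Rightarrow> 'a iso_class \<Rightarrow> 'b iso_class" where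
  "class_map j f A = iso_rel j `` ((\<lambda>(I, a). (I, f I a)) ` A)"


section \<open>Associative presheaves\<close>

text \<open>
  \<open>m I J\<close> is the product from \<open>h[I] \<times> h[J]\<close> to \<open>h[I \<union> J]\<close> for disjoint \<open>I\<close>, \<open>J\<close>.
  \<open>prod_natural\<close> is naturality under injections which respect the decompositions;
  with \<open>\<phi> = id\<close> it reads \<open>(a * b)|\<^bsub>A \<union> B\<^esub> = a|\<^sub>A * b|\<^sub>B\<close>.
\<close>

locale associative_presheaf = combinatorial_presheaf h
  for h :: "'a presheaf" +
  fixes m :: "nat set \<Rightarrow> nat set \<Rightarrow> 'a \<Rightarrow> 'a \<Rightarrow> 'a" and e :: 'a
  assumes prod_closed:
      "\<lbrakk>finite I; finite J; I \<inter> J = {}; a \<in> obj h I; b \<in> obj h J\<rbrakk> \<Longrightarrow> m I J a b \<in> obj h (I \<union> J)"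
    and prod_natural:
      "\<lbrakk>finite I; finite J; I \<inter> J = {}; a \<in> obj h I; b \<in> obj h J;
        finite A; finite B; A \<inter> B = {}; inj_on \<phi> (A \<union> B); \<phi> \<in> A \<rightarrow> I; \<phi> \<in> B \<rightarrow> J\<rbrakk>
        \<Longrightarrow> act h (A \<union> B) (I \<union> J) \<phi> (m I J a b) = m A B (act h A I \<phi> a) (act h B J \<phi> b)"
    and prod_assoc:
      "\<lbrakk>finite I; finite J; finite K; I \<inter> J = {}; I \<inter> K = {}; J \<inter> K = {};
        a \<in> obj h I; b \<in> obj h J; c \<in> obj h K\<rbrakk>
        \<Longrightarrow> m (I \<union> J) K (m I J a b) c = m I (J \<union> K) a (m J K b c)"
    and unit_closed: "e \<in> obj h {}"
    and unit_left: "\<lbrakk>finite I; a \<in> obj h I\<rbrakk> \<Longrightarrow> m {} I e a = a"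
    and unit_right: "\<lbrakk>finite I; a \<in> obj h I\<rbrakk> \<Longrightarrow> m I {} a e = a"

definition connected_presheaf :: "'a presheaf \<Rightarrow> bool" where
  "connected_presheaf h \<longleftrightarrow> card (obj h {}) = 1"

definition associative_morphism ::
    "(nat set \<Rightarrow> nat set \<Rightarrow> 'a \<Rightarrow> 'a \<Rightarrow> 'a) \<Rightarrow> 'a \<Rightarrow> (nat set \<Rightarrow> nat set \<Rightarrow> 'b \<Rightarrow> 'b \<Rightarrow> 'b) \<Rightarrow> 'b \<Rightarrow>
     'a presheaf \<Rightarrow> 'b presheaf \<Rightarrow> (nat set \<Rightarrow> 'a \<Rightarrow> 'b) \<Rightarrow> bool" where
  "associative_morphism mh eh mj ej h j f \<longleftrightarrow>
     presheaf_morphism h j f \<and> f {} eh = ej \<and>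
     (\<forall>I J b c. finite I \<and> finite J \<and> I \<inter> J = {} \<and> b \<in> obj h I \<and> c \<in> obj h J \<longrightarrow>
        f (I \<union> J) (mh I J b c) = mj I J (f I b) (f J c))"

text \<open>
  The product on \<open>\<G>(h)\<close>: the class of \<open>a * b\<close> for representatives \<open>a\<close>, \<open>b\<close> with disjoint label sets.
\<close>

definition class_mult ::
    "'a presheaf \<Rightarrow> (nat set \<Rightarrow> nat set \<Rightarrow> 'a \<Rightarrow> 'a \<Rightarrow> 'a) \<Rightarrow> 'a iso_class \<Rightarrow> 'a iso_class \<Rightarrow> 'a iso_class" where
  "class_mult h m A B =
     iso_rel h `` {(I \<union> J, m I J a b) | I a J b. (I, a) \<in> A \<and> (J, b) \<in> B \<and> I \<inter> J = {}}"

definition class_unit :: "'a presheaf \<Rightarrow> 'a \<Rightarrow> 'a iso_class" where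
  "class_unit h e = iso_rel h `` {({}, e)}"


section \<open>Spaces of rational functions, linear extension and tensor products\<close>

definition fscale :: "rat \<Rightarrow> ('x \<Rightarrow> rat) \<Rightarrow> ('x \<Rightarrow> rat)" where
  "fscale c F = (\<lambda>x. c * F x)"

interpretation fs: vector_space fscale
  by unfold_locales (auto simp: fscale_def fun_eq_iff algebra_simps)

text \<open>
  Linear maps between subspaces \<open>V\<close>, \<open>W\<close>, with scalar multiplications \<open>s\<close>, \<open>t\<close>, made unique
  as HOL functions by taking the value \<open>undefined\<close> outside \<open>V\<close>.
\<close>

definition linear_maps ::
    "(rat \<Rightarrow> 'v \<Rightarrow> 'v) \<Rightarrow> (rat \<Rightarrow> 'w \<Rightarrow> 'w) \<Rightarrow> 'v::ab_group_add set \<Rightarrow> 'w::ab_group_add set \<Rightarrow> ('v \<Rightarrow> 'w) set"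
  where
  "linear_maps s t V W =
     {L \<in> V \<rightarrow>\<^sub>E W. (\<forall>x\<in>V. \<forall>y\<in>V. L (x + y) = L x + L y) \<and> (\<forall>c. \<forall>x\<in>V. L (s c x) = t c (L x))}"

definition is_linear_extension ::
    "(rat \<Rightarrow> 'v \<Rightarrow> 'v) \<Rightarrow> (rat \<Rightarrow> 'w \<Rightarrow> 'w) \<Rightarrow> 'v::ab_group_add set \<Rightarrow> 'w::ab_group_add set \<Rightarrow>
     'i set \<Rightarrow> ('i \<Rightarrow> 'v) \<Rightarrow> ('i \<Rightarrow> 'w) \<Rightarrow> ('v \<Rightarrow> 'w) \<Rightarrow> bool" where
  "is_linear_extension s t V W I v g L \<longleftrightarrow> L \<in> linear_maps s t V W \<and> (\<forall>i\<in>I. L (v i) = g i)"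

definition linear_extension ::
    "(rat \<Rightarrow> 'v \<Rightarrow> 'v) \<Rightarrow> (rat \<Rightarrow> 'w \<Rightarrow> 'w) \<Rightarrow> 'v::ab_group_add set \<Rightarrow> 'w::ab_group_add set \<Rightarrow>
     'i set \<Rightarrow> ('i \<Rightarrow> 'v) \<Rightarrow> ('i \<Rightarrow> 'w) \<Rightarrow> ('v \<Rightarrow> 'w)" where
  "linear_extension s t V W I v g = (THE L. is_linear_extension s t V W I v g L)"

text \<open>
  The tensor product of two spaces of functions, realized inside the functions of two variables;
  its universal property is \<open>tensor_universal\<close> below.
\<close>

definition tensor :: "('x \<Rightarrow> rat) \<Rightarrow> ('y \<Rightarrow> rat) \<Rightarrow> ('x \<times> 'y \<Rightarrow> rat)" (infixr "\<otimes>" 70) where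
  "F \<otimes> G = (\<lambda>(x, y). F x * G y)"

definition tensor_space :: "('x \<Rightarrow> rat) set \<Rightarrow> ('y \<Rightarrow> rat) set \<Rightarrow> ('x \<times> 'y \<Rightarrow> rat) set" where
  "tensor_space A B = fs.span {F \<otimes> G | F G. F \<in> A \<and> G \<in> B}"

lemma tensor_add_left: "(F + F') \<otimes> G = F \<otimes> G + F' \<otimes> G"
  and tensor_add_right: "F \<otimes> (G + G') = F \<otimes> G + F \<otimes> G'"
  and tensor_scale_left: "fscale c F \<otimes> G = fscale c (F \<otimes> G)"
  and tensor_scale_right: "F \<otimes> fscale c G = fscale c (F \<otimes> G)"
  by (auto simp: tensor_def fscale_def fun_eq_iff algebra_simps)

lemma tensor_zero_left: "0 \<otimes> G = 0" and tensor_zero_right: "F \<otimes> 0 = 0"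
  by (auto simp: tensor_def fun_eq_iff)

lemma sum_fun_apply: "(\<Sum>i\<in>I. (F i :: 'x \<Rightarrow> rat)) x = (\<Sum>i\<in>I. F i x)"
  by (induction I rule: infinite_finite_induct) auto

lemma tensor_coefficients_zero:
  assumes "fs.independent C" "fs.independent D" "finite C'" "C' \<subseteq> C" "finite D'" "D' \<subseteq> D"
    and zero: "(\<Sum>c\<in>C'. \<Sum>d\<in>D'. fscale (r c d) (c \<otimes> d)) = 0" and "c \<in> C'" "d \<in> D'"
  shows "r c d = 0"
proof -
  have inner: "(\<Sum>c\<in>C'. r c d * c x) = 0" if "d \<in> D'" for d x
  proof -
    have "(\<Sum>d\<in>D'. fscale (\<Sum>c\<in>C'. r c d * c x) d) = 0"
    proof
      fix y
      have "(\<Sum>d\<in>D'. fscale (\<Sum>c\<in>C'. r c d * c x) d) y = (\<Sum>d\<in>D'. \<Sum>c\<in>C'. r c d * (c x * d y))"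
        by (simp add: sum_fun_apply fscale_def sum_distrib_right mult.assoc)
      also have "\<dots> = (\<Sum>c\<in>C'. \<Sum>d\<in>D'. fscale (r c d) (c \<otimes> d)) (x, y)"
        by (subst sum.swap) (simp add: sum_fun_apply fscale_def tensor_def)
      finally show "(\<Sum>d\<in>D'. fscale (\<Sum>c\<in>C'. r c d * c x) d) y = 0 y"
        by (simp add: zero)
    qed
    then show ?thesis
      using fs.independentD[OF assms(2), of D' "\<lambda>d. \<Sum>c\<in>C'. r c d * c x"] assms(5,6) that by auto
  qed
  have "(\<Sum>c\<in>C'. fscale (r c d) c) = 0"
    using inner[OF \<open>d \<in> D'\<close>] by (auto simp: fun_eq_iff sum_fun_apply fscale_def)
  then show ?thesis
    using fs.independentD[OF assms(1), of C' "\<lambda>c. r c d"] assms(3,4,8) by auto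
qed

lemma tensor_basis:
  assumes C: "fs.independent C" and D: "fs.independent D"
  shows "inj_on (\<lambda>(c, d). c \<otimes> d) (C \<times> D)"
    and "fs.independent ((\<lambda>(c, d). c \<otimes> d) ` (C \<times> D))"
proof -
  show inj: "inj_on (\<lambda>(c, d). c \<otimes> d) (C \<times> D)"
  proof (rule inj_onI, clarify)
    fix c d c' d'
    assume *: "c \<in> C" "d \<in> D" "c' \<in> C" "d' \<in> D" "c \<otimes> d = c' \<otimes> d'"
    show "c = c' \<and> d = d'"
    proof (rule ccontr)
      assume ne: "\<not> (c = c' \<and> d = d')"
      define r where "r = (\<lambda>a b. (if a = c \<and> b = d then 1 else 0 :: rat) - (if a = c' \<and> b = d' then 1 else 0))"
      have pt: "(\<Sum>a\<in>{c, c'}. \<Sum>b\<in>{d, d'}. fscale (if a = p \<and> b = q then 1 else 0) (a \<otimes> b)) = p \<otimes> q"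
        if "p \<in> {c, c'}" "q \<in> {d, d'}" for p q
      proof -
        have "(\<Sum>b\<in>{d, d'}. fscale (if a = p \<and> b = q then 1 else 0) (a \<otimes> b))
            = (if a = p then a \<otimes> q else 0)" for a
        proof -
          have "(\<Sum>b\<in>{d, d'}. fscale (if a = p \<and> b = q then 1 else 0) (a \<otimes> b))
              = (\<Sum>b\<in>{d, d'}. if b = q then (if a = p then a \<otimes> q else 0) else 0)"
            by (rule sum.cong) auto
          also have "\<dots> = (if a = p then a \<otimes> q else 0)"
            by (subst sum.delta) (use that in auto)
          finally show ?thesis .
        qed
        then have "(\<Sum>a\<in>{c, c'}. \<Sum>b\<in>{d, d'}. fscale (if a = p \<and> b = q then 1 else 0) (a \<otimes> b))
            = (\<Sum>a\<in>{c, c'}. if a = p then p \<otimes> q else 0)"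
          by (intro sum.cong) auto
        also have "\<dots> = p \<otimes> q"
          by (subst sum.delta) (use that in auto)
        finally show ?thesis .
      qed
      have "(\<Sum>a\<in>{c, c'}. \<Sum>b\<in>{d, d'}. fscale (r a b) (a \<otimes> b)) = c \<otimes> d - c' \<otimes> d'"
        unfolding r_def fs.scale_left_diff_distrib sum_subtractf
        using pt[of c d] pt[of c' d'] by simp
      then have "(\<Sum>a\<in>{c, c'}. \<Sum>b\<in>{d, d'}. fscale (r a b) (a \<otimes> b)) = 0"
        using * by simp
      then have "r c d = 0"
        using * by (intro tensor_coefficients_zero[OF C D, of "{c, c'}" "{d, d'}"]) auto
      then show False
        using ne by (auto simp: r_def split: if_splits)
    qed
  qed
  show "fs.independent ((\<lambda>(c, d). c \<otimes> d) ` (C \<times> D))"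
  unfolding fs.dependent_explicit
  proof clarify
    fix t u v
    assume t: "finite t" "t \<subseteq> (\<lambda>(c, d). c \<otimes> d) ` (C \<times> D)"
      and v: "v \<in> t" and nz: "u v \<noteq> 0" and zero: "(\<Sum>p\<in>t. fscale (u p) p) = 0"
    obtain t' where t': "t' \<subseteq> C \<times> D" "finite t'" "t = (\<lambda>(c, d). c \<otimes> d) ` t'"
      using finite_subset_image[OF t] by metis
    define r where "r = (\<lambda>c d. if (c, d) \<in> t' then u (c \<otimes> d) else 0)"
    have "(\<Sum>c\<in>fst ` t'. \<Sum>d\<in>snd ` t'. fscale (r c d) (c \<otimes> d))
        = (\<Sum>(c, d)\<in>fst ` t' \<times> snd ` t'. fscale (r c d) (c \<otimes> d))"
      using t' by (simp add: sum.cartesian_product)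
    also have "\<dots> = (\<Sum>(c, d)\<in>t'. fscale (u (c \<otimes> d)) (c \<otimes> d))"
      using t' by (intro sum.mono_neutral_cong_right) (auto simp: r_def image_iff, force+)
    also have "\<dots> = (\<Sum>p\<in>t. fscale (u p) p)"
      unfolding t'(3) by (subst sum.reindex[OF inj_on_subset[OF inj t'(1)]]) (simp add: case_prod_unfold)
    finally have *: "(\<Sum>c\<in>fst ` t'. \<Sum>d\<in>snd ` t'. fscale (r c d) (c \<otimes> d)) = 0"
      using zero by simp
    obtain c d where cd: "(c, d) \<in> t'" "v = c \<otimes> d"
      using v t'(3) by auto
    have "r c d = 0"
      by (rule tensor_coefficients_zero[OF C D _ _ _ _ *]) (use t' cd in \<open>force+\<close>)
    then show False
      using cd nz by (simp add: r_def)
  qed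
qed

lemma tensor_universal:
  fixes s :: "rat \<Rightarrow> 'w::ab_group_add \<Rightarrow> 'w"
  assumes A: "fs.subspace A" and B: "fs.subspace B" and s: "vector_space s"
    and add_left: "\<And>F F' G. \<lbrakk>F \<in> A; F' \<in> A; G \<in> B\<rbrakk> \<Longrightarrow> \<beta> (F + F') G = \<beta> F G + \<beta> F' G"
    and add_right: "\<And>F G G'. \<lbrakk>F \<in> A; G \<in> B; G' \<in> B\<rbrakk> \<Longrightarrow> \<beta> F (G + G') = \<beta> F G + \<beta> F G'"
    and scale_left: "\<And>c F G. \<lbrakk>F \<in> A; G \<in> B\<rbrakk> \<Longrightarrow> \<beta> (fscale c F) G = s c (\<beta> F G)"
    and scale_right: "\<And>c F G. \<lbrakk>F \<in> A; G \<in> B\<rbrakk> \<Longrightarrow> \<beta> F (fscale c G) = s c (\<beta> F G)"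
  shows "\<exists>!T. is_linear_extension fscale s (tensor_space A B) UNIV
    (A \<times> B) (\<lambda>(F, G). F \<otimes> G) (\<lambda>(F, G). \<beta> F G) T"
proof -
  interpret s: vector_space s by (fact s)
  interpret P: vector_space_pair "fscale :: rat \<Rightarrow> ('a \<times> 'b \<Rightarrow> rat) \<Rightarrow> _" s ..
  obtain C where C: "C \<subseteq> A" "fs.independent C" "A \<subseteq> fs.span C"
    by (metis fs.basis_exists)
  obtain D where D: "D \<subseteq> B" "fs.independent D" "B \<subseteq> fs.span D"
    by (metis fs.basis_exists)
  have span: "fs.span C = A" "fs.span D = B"
    using C D A B by (metis fs.span_minimal subset_antisym)+
  let ?t = "\<lambda>(c, d). c \<otimes> d"
  note basis = tensor_basis[OF C(2) D(2)]
  obtain T where T: "Vector_Spaces.linear fscale s T"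
    and T_basis: "\<And>p. p \<in> ?t ` (C \<times> D) \<Longrightarrow> T p = (case inv_into (C \<times> D) ?t p of (c, d) \<Rightarrow> \<beta> c d)"
    using P.linear_independent_extend[OF basis(2), of "\<lambda>p. case inv_into (C \<times> D) ?t p of (c, d) \<Rightarrow> \<beta> c d"]
    by blast
  interpret T: Vector_Spaces.linear fscale s T by (fact T)
  have T1: "T (c \<otimes> d) = \<beta> c d" if "c \<in> C" "d \<in> D" for c d
    using T_basis[of "c \<otimes> d"] inv_into_f_f[OF basis(1), of "(c, d)"] that by force
  have zeroA: "0 \<in> A" and zeroB: "0 \<in> B"
    using A B fs.subspace_0 by auto
  have b0: "\<beta> 0 G = 0" if "G \<in> B" for G
    using scale_left[OF zeroA that, of 0] by simp
  have b0': "\<beta> F 0 = 0" if "F \<in> A" for F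
    using scale_right[OF that zeroB, of 0] by simp
  have T2: "F \<in> A \<and> (\<forall>d\<in>D. T (F \<otimes> d) = \<beta> F d)" if "F \<in> fs.span C" for F
    using that
  proof (induction rule: fs.span_induct_alt)
    case base
    then show ?case using zeroA b0 D(1) tensor_zero_left T.zero by (metis subsetD)
  next
    case (step c x y)
    then have "x \<in> A" "y \<in> A" "fscale c x \<in> A" "fscale c x + y \<in> A"
      using C(1) A by (auto simp: fs.subspace_scale fs.subspace_add)
    moreover have "T ((fscale c x + y) \<otimes> d) = \<beta> (fscale c x + y) d" if "d \<in> D" for d
    proof -
      have "T ((fscale c x + y) \<otimes> d) = s c (\<beta> x d) + \<beta> y d"
        unfolding tensor_add_left tensor_scale_left T.add T.scale using step T1 that by simp
      then show ?thesis
        using add_left[of "fscale c x" y d] scale_left[of x d c] calculation D(1) that by auto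
    qed
    ultimately show ?case by blast
  qed
  have T3: "G \<in> B \<and> T (F \<otimes> G) = \<beta> F G" if "F \<in> A" "G \<in> fs.span D" for F G
    using that(2)
  proof (induction rule: fs.span_induct_alt)
    case base
    then show ?case using zeroB b0'[OF that(1)] tensor_zero_right T.zero by metis
  next
    case (step c x y)
    then have "x \<in> B" "y \<in> B" "fscale c x \<in> B" "fscale c x + y \<in> B"
      using D(1) B by (auto simp: fs.subspace_scale fs.subspace_add)
    moreover have "T (F \<otimes> x) = \<beta> F x"
      using T2[of F] that step span by auto
    moreover have "T (F \<otimes> (fscale c x + y)) = s c (T (F \<otimes> x)) + T (F \<otimes> y)"
      unfolding tensor_add_right tensor_scale_right T.add T.scale ..
    ultimately show ?case
      using step \<open>F \<in> A\<close> add_right[of F "fscale c x" y] scale_right[of F x c] by metis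
  qed
  let ?V = "tensor_space A B"
  have V: "fs.subspace ?V" by (simp add: tensor_space_def)
  have in_V: "F \<otimes> G \<in> ?V" if "F \<in> A" "G \<in> B" for F G
    unfolding tensor_space_def using that by (intro fs.span_base) auto
  show ?thesis
  proof (rule ex1I)
    show "is_linear_extension fscale s ?V UNIV (A \<times> B) (\<lambda>(F, G). F \<otimes> G) (\<lambda>(F, G). \<beta> F G)
      (restrict T ?V)"
      unfolding is_linear_extension_def linear_maps_def
    proof (intro conjI CollectI ballI allI)
      show "restrict T ?V \<in> ?V \<rightarrow>\<^sub>E UNIV" by simp
    next
      fix x y assume "x \<in> ?V" "y \<in> ?V"
      then show "restrict T ?V (x + y) = restrict T ?V x + restrict T ?V y"
        by (simp only: restrict_apply' fs.subspace_add[OF V] T.add)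
    next
      fix c x assume "x \<in> ?V"
      then show "restrict T ?V (fscale c x) = s c (restrict T ?V x)"
        by (simp only: restrict_apply' fs.subspace_scale[OF V] T.scale)
    next
      fix p assume "p \<in> A \<times> B"
      then show "restrict T ?V (case p of (F, G) \<Rightarrow> F \<otimes> G) = (case p of (F, G) \<Rightarrow> \<beta> F G)"
        using T3 span in_V by (auto simp only: split: prod.split)
          (simp add: restrict_apply')
    qed
  next
    fix T'
    assume T': "is_linear_extension fscale s ?V UNIV (A \<times> B) (\<lambda>(F, G). F \<otimes> G) (\<lambda>(F, G). \<beta> F G) T'"
    have add': "T' (x + y) = T' x + T' y" if "x \<in> ?V" "y \<in> ?V" for x y
      using T' that by (auto simp: is_linear_extension_def linear_maps_def)
    have scale': "T' (fscale c x) = s c (T' x)" if "x \<in> ?V" for c x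
      using T' that by (auto simp: is_linear_extension_def linear_maps_def)
    have gen': "T' (F \<otimes> G) = \<beta> F G" if "F \<in> A" "G \<in> B" for F G
      using T' that by (auto simp: is_linear_extension_def)
    have zero': "T' 0 = 0"
      using scale'[of 0 0] fs.subspace_0[OF V] by simp
    have "T' x = T x \<and> x \<in> ?V" if "x \<in> ?V" for x
      using that[unfolded tensor_space_def]
    proof (induction rule: fs.span_induct_alt)
      case base
      show ?case using zero' T.zero fs.subspace_0[OF V] by metis
    next
      case (step c x y)
      then obtain F G where FG: "F \<in> A" "G \<in> B" "x = F \<otimes> G" by auto
      then have *: "T' x = T x" "x \<in> ?V" "T' y = T y" "y \<in> ?V"
        using gen'[of F G] T3[of F G] in_V[of F G] span step.IH by simp_all
      then have "fscale c x \<in> ?V" "fscale c x + y \<in> ?V"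
        using V by (simp_all only: fs.subspace_scale fs.subspace_add)
      with * show ?case
        by (simp only: add' scale' T.add T.scale simp_thms)
    qed
    then have "T' x = T x" if "x \<in> ?V" for x
      using that by blast
    moreover have "T' \<in> extensional ?V"
      using T' by (auto simp: is_linear_extension_def linear_maps_def PiE_def)
    ultimately show "T' = restrict T ?V"
      by (intro extensionalityI[of _ ?V]) simp_all
  qed
qed

definition tensor_map ::
    "('x \<Rightarrow> rat) set \<Rightarrow> ('y \<Rightarrow> rat) set \<Rightarrow> ('x2 \<Rightarrow> rat) set \<Rightarrow> ('y2 \<Rightarrow> rat) set \<Rightarrow>
     (('x \<Rightarrow> rat) \<Rightarrow> ('x2 \<Rightarrow> rat)) \<Rightarrow> (('y \<Rightarrow> rat) \<Rightarrow> ('y2 \<Rightarrow> rat)) \<Rightarrow> ('x \<times> 'y \<Rightarrow> rat) \<Rightarrow> ('x2 \<times> 'y2 \<Rightarrow> rat)"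
  where
  "tensor_map A B A2 B2 K L =
     linear_extension fscale fscale (tensor_space A B) (tensor_space A2 B2)
       (A \<times> B) (\<lambda>(F, G). F \<otimes> G) (\<lambda>(F, G). K F \<otimes> L G)"


section \<open>Morphisms of algebras, bialgebras and Hopf algebras of functions\<close>

text \<open>Algebras of rational functions on \<^typ>\<open>'x\<close> with the pointwise product.\<close>

record 'x fun_algebra =
  carr :: "('x \<Rightarrow> rat) set"
  unt :: "'x \<Rightarrow> rat"

record 'x fun_bialgebra = "'x fun_algebra" +
  comult :: "('x \<Rightarrow> rat) \<Rightarrow> ('x \<times> 'x \<Rightarrow> rat)"
  counit :: "('x \<Rightarrow> rat) \<Rightarrow> rat"

definition algebra_morphism ::
    "('x, 'm) fun_algebra_scheme \<Rightarrow> ('y, 'n) fun_algebra_scheme \<Rightarrow> (('x \<Rightarrow> rat) \<Rightarrow> ('y \<Rightarrow> rat)) \<Rightarrow> bool" where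
  "algebra_morphism A B L \<longleftrightarrow>
     L \<in> linear_maps fscale fscale (carr A) (carr B) \<and>
     (\<forall>F\<in>carr A. \<forall>G\<in>carr A. L (F * G) = L F * L G) \<and>
     L (unt A) = unt B"

definition coalgebra_morphism ::
    "('x, 'm) fun_bialgebra_scheme \<Rightarrow> ('y, 'n) fun_bialgebra_scheme \<Rightarrow> (('x \<Rightarrow> rat) \<Rightarrow> ('y \<Rightarrow> rat)) \<Rightarrow> bool" where
  "coalgebra_morphism A B L \<longleftrightarrow>
     L \<in> linear_maps fscale fscale (carr A) (carr B) \<and>
     (\<forall>F\<in>carr A. comult B (L F) = tensor_map (carr A) (carr A) (carr B) (carr B) L L (comult A F)) \<and>
     (\<forall>F\<in>carr A. counit B (L F) = counit A F)"

definition bialgebra_morphism ::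
    "('x, 'm) fun_bialgebra_scheme \<Rightarrow> ('y, 'n) fun_bialgebra_scheme \<Rightarrow> (('x \<Rightarrow> rat) \<Rightarrow> ('y \<Rightarrow> rat)) \<Rightarrow> bool" where
  "bialgebra_morphism A B L \<longleftrightarrow> algebra_morphism A B L \<and> coalgebra_morphism A B L"

definition mult_map :: "('x, 'm) fun_algebra_scheme \<Rightarrow> ('x \<times> 'x \<Rightarrow> rat) \<Rightarrow> ('x \<Rightarrow> rat)" where
  "mult_map A =
     linear_extension fscale fscale (tensor_space (carr A) (carr A)) (carr A)
       (carr A \<times> carr A) (\<lambda>(F, G). F \<otimes> G) (\<lambda>(F, G). F * G)"

definition is_antipode :: "('x, 'm) fun_bialgebra_scheme \<Rightarrow> (('x \<Rightarrow> rat) \<Rightarrow> ('x \<Rightarrow> rat)) \<Rightarrow> bool" where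
  "is_antipode A S \<longleftrightarrow>
     S \<in> linear_maps fscale fscale (carr A) (carr A) \<and>
     (\<forall>F\<in>carr A.
        mult_map A (tensor_map (carr A) (carr A) (carr A) (carr A) S id (comult A F))
          = fscale (counit A F) (unt A) \<and>
        mult_map A (tensor_map (carr A) (carr A) (carr A) (carr A) id S (comult A F))
          = fscale (counit A F) (unt A))"

definition hopf_morphism ::
    "('x, 'm) fun_bialgebra_scheme \<Rightarrow> ('y, 'n) fun_bialgebra_scheme \<Rightarrow> (('x \<Rightarrow> rat) \<Rightarrow> ('y \<Rightarrow> rat)) \<Rightarrow> bool" where
  "hopf_morphism A B L \<longleftrightarrow>
     bialgebra_morphism A B L \<and>
     (\<exists>S T. is_antipode A S \<and> is_antipode B T \<and> (\<forall>F\<in>carr A. L (S F) = T (L F)))"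


section \<open>Pattern algebras\<close>

text \<open>
  \<open>\<A>(h)\<close> consists of functions on \<open>\<G>(h)\<close>, extended by 0 to the whole type. Pattern counts are
  invariant under relabeling, so the choice of a representative \<open>b\<close> in \<open>h[I]\<close> is immaterial.
\<close>

definition pattern_count :: "'a presheaf \<Rightarrow> 'a iso_class \<Rightarrow> nat set \<times> 'a \<Rightarrow> nat" where
  "pattern_count h a = (\<lambda>(I, b). card {J. J \<subseteq> I \<and> (J, restr h I J b) \<in> a})"

definition pattern_fun :: "'a presheaf \<Rightarrow> 'a iso_class \<Rightarrow> ('a iso_class \<Rightarrow> rat)" where
  "pattern_fun h a B = (if B \<in> \<G> h then of_nat (pattern_count h a (SOME b. b \<in> B)) else 0)"

definition pattern_space :: "'a presheaf \<Rightarrow> ('a iso_class \<Rightarrow> rat) set" ("\<A>") where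
  "\<A> h = fs.span (pattern_fun h ` \<G> h)"

definition pattern_algebra :: "'a presheaf \<Rightarrow> 'a iso_class fun_algebra" where
  "pattern_algebra h = \<lparr>carr = \<A> h, unt = (\<lambda>B. if B \<in> \<G> h then 1 else 0)\<rparr>"

definition pattern_comult ::
    "'a presheaf \<Rightarrow> (nat set \<Rightarrow> nat set \<Rightarrow> 'a \<Rightarrow> 'a \<Rightarrow> 'a) \<Rightarrow>
     ('a iso_class \<Rightarrow> rat) \<Rightarrow> ('a iso_class \<times> 'a iso_class \<Rightarrow> rat)" where
  "pattern_comult h m =
     linear_extension fscale fscale (\<A> h) (tensor_space (\<A> h) (\<A> h)) (\<G> h) (pattern_fun h)
       (\<lambda>a. \<Sum>(b, c) \<in> {(b, c). b \<in> \<G> h \<and> c \<in> \<G> h \<and> class_mult h m b c = a}.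
              pattern_fun h b \<otimes> pattern_fun h c)"

definition pattern_counit :: "'a presheaf \<Rightarrow> 'a \<Rightarrow> ('a iso_class \<Rightarrow> rat) \<Rightarrow> rat" where
  "pattern_counit h e =
     linear_extension fscale (*) (\<A> h) UNIV (\<G> h) (pattern_fun h)
       (\<lambda>a. if a = class_unit h e then 1 else 0)"

definition pattern_bialgebra ::
    "'a presheaf \<Rightarrow> (nat set \<Rightarrow> nat set \<Rightarrow> 'a \<Rightarrow> 'a \<Rightarrow> 'a) \<Rightarrow> 'a \<Rightarrow> 'a iso_class fun_bialgebra" where
  "pattern_bialgebra h m e =
     fun_algebra.extend (pattern_algebra h)
       (fun_bialgebra.fields (pattern_comult h m) (pattern_counit h e))"

definition is_pattern_map ::
    "'a presheaf \<Rightarrow> 'b presheaf \<Rightarrow> (nat set \<Rightarrow> 'a \<Rightarrow> 'b) \<Rightarrow>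
     (('b iso_class \<Rightarrow> rat) \<Rightarrow> ('a iso_class \<Rightarrow> rat)) \<Rightarrow> bool" where
  "is_pattern_map h j f =
     is_linear_extension fscale fscale (\<A> j) (\<A> h) (\<G> j) (pattern_fun j)
       (\<lambda>a. \<Sum>b \<in> {b \<in> \<G> h. class_map j f b = a}. pattern_fun h b)"

definition pattern_map ::
    "'a presheaf \<Rightarrow> 'b presheaf \<Rightarrow> (nat set \<Rightarrow> 'a \<Rightarrow> 'b) \<Rightarrow>
     (('b iso_class \<Rightarrow> rat) \<Rightarrow> ('a iso_class \<Rightarrow> rat))" where
  "pattern_map h j f = (THE L. is_pattern_map h j f L)"

end

theory Submission
  imports Defs
begin

text \<open>
  Naturality of \<open>f\<close> makes \<open>\<A>[f]\<close> the pullback of functions along the induced map \<open>\<G>(h) \<rightarrow> \<G>(j)\<close>: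
  counting the \<open>J\<close> with \<open>f(x)|\<^sub>J \<sim> a\<close> according to the class of \<open>x|\<^sub>J\<close> gives \<open>p\<^sub>a \<circ> f\<close> as the sum of the
  \<open>p\<^sub>b\<close> with \<open>f(b) = a\<close>. In the same way the coproduct is the pullback along the product of \<open>\<G>(h)\<close> and
  the counit is evaluation at the unit, so that compatibility of \<open>\<A>[f]\<close> with them says that \<open>f\<close> is a
  monoid morphism on classes. In the connected case \<open>\<G>(h)\<close> is graded by size with only the unit in
  degree 0, and the antipode sends \<open>p\<^sub>a\<close> to the sum, over all factorizations of \<open>a\<close> into a word
  \<open>a\<^sub>1, \<dots>, a\<^sub>k\<close> of non-units, of \<open>(-1)\<^sup>k p\<^bsub>a\<^sub>1\<^esub> \<dots> p\<^bsub>a\<^sub>k\<^esub>\<close>; words in \<open>\<G>(h)\<close> are sorted by their images in \<open>\<G>(j)\<close>.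
\<close>


section \<open>Linear maps on spans\<close>

text \<open>Linearity on \<open>V\<close> alone, without the extensionality that
  \<open>linear_maps\<close> demands. Total functions such as pullbacks can thus be handled directly
  and are cut down by \<open>restrict\<close> only at the end.\<close>

definition linear_on ::
    "(rat \<Rightarrow> 'w \<Rightarrow> 'w) \<Rightarrow> ('x \<Rightarrow> rat) set \<Rightarrow> (('x \<Rightarrow> rat) \<Rightarrow> 'w::ab_group_add) \<Rightarrow> bool" where
  "linear_on t V K \<longleftrightarrow>
     (\<forall>x\<in>V. \<forall>y\<in>V. K (x + y) = K x + K y) \<and> (\<forall>c. \<forall>x\<in>V. K (fscale c x) = t c (K x))"

lemma linear_on_add: "linear_on t V K \<Longrightarrow> x \<in> V \<Longrightarrow> y \<in> V \<Longrightarrow> K (x + y) = K x + K y"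
  and linear_on_scale: "linear_on t V K \<Longrightarrow> x \<in> V \<Longrightarrow> K (fscale c x) = t c (K x)"
  by (auto simp: linear_on_def)

lemma linear_on_zero:
  assumes "linear_on t V K" "fs.subspace V"
  shows "K 0 = 0"
  using linear_on_add[OF assms(1), of 0 0] fs.subspace_0[OF assms(2)] by simp

lemma linear_on_sum:
  assumes "linear_on t V K" "fs.subspace V" "\<And>i. i \<in> S \<Longrightarrow> g i \<in> V"
  shows "K (\<Sum>i\<in>S. g i) = (\<Sum>i\<in>S. K (g i))"
  using assms(3)
proof (induction S rule: infinite_finite_induct)
  case (insert i S)
  then have "K (g i + sum g S) = K (g i) + K (sum g S)"
    by (intro linear_on_add[OF assms(1)] fs.subspace_sum[OF assms(2)]) auto
  with insert show ?case by (simp only: sum.insert simp_thms insert_iff)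
qed (simp_all add: linear_on_zero[OF assms(1,2)])

lemma linear_on_compose:
  assumes "linear_on fscale V K" "linear_on t W K'" "\<And>x. x \<in> V \<Longrightarrow> K x \<in> W"
  shows "linear_on t V (\<lambda>x. K' (K x))"
  using assms by (simp add: linear_on_def)

lemma linear_on_restrict:
  "fs.subspace V \<Longrightarrow> linear_on t V (restrict K V) \<longleftrightarrow> linear_on t V K"
  by (simp add: linear_on_def fs.subspace_add fs.subspace_scale)

lemma linear_on_span_eq:
  assumes K: "linear_on t (fs.span B) K" and K': "linear_on t (fs.span B) K'"
    and eq: "\<And>x. x \<in> B \<Longrightarrow> K x = K' x" and x: "x \<in> fs.span B"
  shows "K x = K' x"
proof -
  \<comment> \<open>Membership is carried through the induction because \<open>K\<close> and
    \<open>K'\<close> are additive on the span only.\<close>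
  have "x \<in> fs.span B \<and> K x = K' x"
    using x
  proof (induction rule: fs.span_induct_alt)
    case base
    then show ?case
      using linear_on_zero[OF K fs.subspace_span] linear_on_zero[OF K' fs.subspace_span]
        fs.span_zero[of B] by (simp only: simp_thms)
  next
    case (step c x y)
    then have "x \<in> fs.span B" "fscale c x \<in> fs.span B"
      by (simp_all add: fs.span_base fs.span_scale)
    with step show ?case
      by (simp only: simp_thms fs.span_add linear_on_add[OF K] linear_on_add[OF K']
          linear_on_scale[OF K] linear_on_scale[OF K'] eq)
  qed
  then show ?thesis ..
qed

lemma linear_on_span_into:
  assumes K: "linear_on fscale (fs.span B) K" and W: "fs.subspace W"
    and into: "\<And>x. x \<in> B \<Longrightarrow> K x \<in> W" and x: "x \<in> fs.span B"
  shows "K x \<in> W"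
proof -
  have "x \<in> fs.span B \<and> K x \<in> W"
    using x
  proof (induction rule: fs.span_induct_alt)
    case base
    then show ?case
      using linear_on_zero[OF K fs.subspace_span] fs.subspace_0[OF W] fs.span_zero[of B]
      by (simp only: simp_thms)
  next
    case (step c x y)
    then have "x \<in> fs.span B" "fscale c x \<in> fs.span B"
      by (simp_all add: fs.span_base fs.span_scale)
    with step show ?case
      by (simp only: simp_thms fs.span_add linear_on_add[OF K] linear_on_scale[OF K] into
          fs.subspace_add[OF W] fs.subspace_scale[OF W])
  qed
  then show ?thesis ..
qed

text \<open>Generators determine a linear map on their span, and extensionality fixes it elsewhere.
  Exhibiting one map \<open>K\<close> with the prescribed values therefore yields existence and
  uniqueness together, which is what evaluates each \<open>THE\<close>.\<close>

lemma is_linear_extension_iff: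
  assumes V: "V = fs.span (v ` I)" and K: "linear_on t V K" and into: "\<And>x. x \<in> V \<Longrightarrow> K x \<in> W"
    and val: "\<And>i. i \<in> I \<Longrightarrow> K (v i) = g i"
  shows "is_linear_extension fscale t V W I v g L \<longleftrightarrow> L = restrict K V"
proof
  assume L: "is_linear_extension fscale t V W I v g L"
  then have "linear_on t V L"
    by (simp add: is_linear_extension_def linear_maps_def linear_on_def)
  moreover have "L (v i) = K (v i)" if "i \<in> I" for i
    using L val that by (simp add: is_linear_extension_def)
  ultimately have "L x = K x" if "x \<in> V" for x
    using linear_on_span_eq[of t "v ` I" L K x] K that unfolding V by auto
  moreover have "L \<in> extensional V"
    using L by (simp add: is_linear_extension_def linear_maps_def PiE_def)
  ultimately show "L = restrict K V"
    by (intro extensionalityI[of _ V]) simp_all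
next
  have sub: "fs.subspace V" and gen: "\<And>i. i \<in> I \<Longrightarrow> v i \<in> V"
    unfolding V by (simp_all add: fs.span_base)
  assume "L = restrict K V"
  then show "is_linear_extension fscale t V W I v g L"
    using K into val gen linear_on_restrict[OF sub, of t K]
    unfolding is_linear_extension_def linear_maps_def linear_on_def by auto
qed

lemma linear_extension_eq:
  assumes "V = fs.span (v ` I)" "linear_on t V K" "\<And>x. x \<in> V \<Longrightarrow> K x \<in> W"
    and "\<And>i. i \<in> I \<Longrightarrow> K (v i) = g i"
  shows "linear_extension fscale t V W I v g = restrict K V"
  unfolding linear_extension_def
  by (rule the_equality) (simp_all only: is_linear_extension_iff[OF assms])

lemma restrict_in_linear_maps:
  assumes "linear_on fscale V K" "fs.subspace V" "\<And>x. x \<in> V \<Longrightarrow> K x \<in> W"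
  shows "restrict K V \<in> linear_maps fscale fscale V W"
  using assms(1,3) linear_on_restrict[OF assms(2), of fscale K]
  unfolding linear_maps_def linear_on_def by auto

text \<open>The value 0 off \<open>X\<close> matches the convention that functions on classes are
  extended by 0 to the whole type.\<close>

definition pullback :: "'x set \<Rightarrow> ('x \<Rightarrow> 'y) \<Rightarrow> ('y \<Rightarrow> rat) \<Rightarrow> 'x \<Rightarrow> rat" where
  "pullback X \<phi> F = (\<lambda>x. if x \<in> X then F (\<phi> x) else 0)"

lemma linear_on_pullback: "linear_on fscale V (pullback X \<phi>)"
  by (auto simp: linear_on_def pullback_def fscale_def)

lemma linear_on_eval: "linear_on (*) V (\<lambda>F. F x)"
  by (auto simp: linear_on_def fscale_def)

lemma linear_on_id: "linear_on fscale V id"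
  by (auto simp: linear_on_def)

section \<open>Maps out of tensor spaces\<close>

lemma subspace_tensor_space: "fs.subspace (tensor_space A B)"
  by (simp add: tensor_space_def)

lemma tensor_space_eq: "tensor_space A B = fs.span ((\<lambda>(F, G). F \<otimes> G) ` (A \<times> B))"
  unfolding tensor_space_def by (rule arg_cong[where f = fs.span]) auto

lemma tensor_in_tensor_space: "F \<in> A \<Longrightarrow> G \<in> B \<Longrightarrow> F \<otimes> G \<in> tensor_space A B"
  unfolding tensor_space_def by (auto intro: fs.span_base)

text \<open>Evaluates a tensor product of maps when a closed formula \<open>M\<close> is at hand;
  \<open>tensor_map_linear\<close> covers maps without such a formula.\<close>

lemma tensor_map_eq:
  assumes "linear_on fscale (tensor_space A B) M"
    and "\<And>F G. F \<in> A \<Longrightarrow> G \<in> B \<Longrightarrow> M (F \<otimes> G) = K F \<otimes> L G"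
    and "\<And>F. F \<in> A \<Longrightarrow> K F \<in> A'" and "\<And>G. G \<in> B \<Longrightarrow> L G \<in> B'"
  shows "tensor_map A B A' B' K L = restrict M (tensor_space A B)"
  unfolding tensor_map_def
proof (rule linear_extension_eq[OF tensor_space_eq assms(1)])
  show "M x \<in> tensor_space A' B'" if "x \<in> tensor_space A B" for x
    by (rule linear_on_span_into[OF assms(1)[unfolded tensor_space_eq] subspace_tensor_space _
          that[unfolded tensor_space_eq]])
      (auto simp: assms(2-4) tensor_in_tensor_space)
qed (use assms(2) in auto)

lemma tensor_map_linear:
  assumes A: "fs.subspace A" and B: "fs.subspace B"
    and K: "linear_on fscale A K" "\<And>F. F \<in> A \<Longrightarrow> K F \<in> A'"
    and L: "linear_on fscale B L" "\<And>G. G \<in> B \<Longrightarrow> L G \<in> B'"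
  shows "linear_on fscale (tensor_space A B) (tensor_map A B A' B' K L)"
    and "\<And>F G. F \<in> A \<Longrightarrow> G \<in> B \<Longrightarrow> tensor_map A B A' B' K L (F \<otimes> G) = K F \<otimes> L G"
    and "\<And>T. T \<in> tensor_space A B \<Longrightarrow> tensor_map A B A' B' K L T \<in> tensor_space A' B'"
proof -
  \<comment> \<open>The universal property supplies \<open>M\<close> with values in the whole
    function space. That it lands in \<open>tensor_space A' B'\<close> is read off from pure
    tensors.\<close>
  have "\<exists>!M. is_linear_extension fscale fscale (tensor_space A B) UNIV (A \<times> B)
      (\<lambda>(F, G). F \<otimes> G) (\<lambda>(F, G). K F \<otimes> L G) M"
    by (rule tensor_universal[OF A B fs.vector_space_axioms])
      (simp_all add: linear_on_add[OF K(1)] linear_on_add[OF L(1)] linear_on_scale[OF K(1)]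
        linear_on_scale[OF L(1)] tensor_add_left tensor_add_right tensor_scale_left tensor_scale_right)
  then obtain M where "is_linear_extension fscale fscale (tensor_space A B) UNIV (A \<times> B)
      (\<lambda>(F, G). F \<otimes> G) (\<lambda>(F, G). K F \<otimes> L G) M"
    by blast
  then have M: "linear_on fscale (tensor_space A B) M"
    and val: "\<And>F G. F \<in> A \<Longrightarrow> G \<in> B \<Longrightarrow> M (F \<otimes> G) = K F \<otimes> L G"
    by (auto simp: is_linear_extension_def linear_maps_def linear_on_def)
  have eq: "tensor_map A B A' B' K L = restrict M (tensor_space A B)"
    by (rule tensor_map_eq[OF M val K(2) L(2)])
  show lin: "linear_on fscale (tensor_space A B) (tensor_map A B A' B' K L)"
    using M by (simp add: eq linear_on_restrict subspace_tensor_space)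
  show vals: "tensor_map A B A' B' K L (F \<otimes> G) = K F \<otimes> L G" if "F \<in> A" "G \<in> B" for F G
    using that by (simp add: eq val tensor_in_tensor_space)
  show "tensor_map A B A' B' K L T \<in> tensor_space A' B'" if "T \<in> tensor_space A B" for T
    by (rule linear_on_span_into[OF lin[unfolded tensor_space_eq] subspace_tensor_space _
          that[unfolded tensor_space_eq], folded tensor_space_eq])
      (auto simp: vals K(2) L(2) tensor_in_tensor_space)
qed

section \<open>Classes and pattern functions\<close>

definition class_of :: "'a presheaf \<Rightarrow> nat set \<Rightarrow> 'a \<Rightarrow> 'a iso_class" where
  "class_of h I a = iso_rel h `` {(I, a)}"

definition objects :: "'a presheaf \<Rightarrow> (nat set \<times> 'a) set" where
  "objects h = {(I, a). finite I \<and> a \<in> obj h I}"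

text \<open>The chosen representative is immaterial, since relabelings are bijections; see
  \<open>class_size_class_of\<close>.\<close>

definition class_size :: "'a iso_class \<Rightarrow> nat" where
  "class_size B = card (fst (SOME x. x \<in> B))"

text \<open>Replaces the condition that a restriction is related to a given object by an equation
  between classes, so that pattern counts become sums of indicators.\<close>

definition pattern_at :: "'a presheaf \<Rightarrow> nat set \<Rightarrow> 'a \<Rightarrow> nat set \<Rightarrow> 'a iso_class" where
  "pattern_at h I a J = class_of h J (restr h I J a)"

lemma bij_betw_in_injections: "bij_betw \<phi> I J \<Longrightarrow> \<phi> \<in> injections I J"
  by (auto simp: injections_def bij_betw_def)

lemma id_in_injections: "J \<subseteq> I \<Longrightarrow> id \<in> injections J I"
  by (auto simp: injections_def)

section \<open>Relabeling classes\<close>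

context combinatorial_presheaf
begin

lemma act_obj_bij:
  "\<lbrakk>finite I; finite J; bij_betw \<phi> I J; b \<in> obj h J\<rbrakk> \<Longrightarrow> act h I J \<phi> b \<in> obj h I"
  by (rule act_closed) (auto intro: bij_betw_in_injections)

lemma restr_closed:
  assumes "finite I" "J \<subseteq> I" "a \<in> obj h I"
  shows "restr h I J a \<in> obj h J"
  using act_closed[OF _ assms(1) id_in_injections[OF assms(2)] assms(3)] assms(1,2)
  by (simp add: restr_def finite_subset)

lemma restr_restr:
  assumes "finite I" "J \<subseteq> I" "K \<subseteq> J" "a \<in> obj h I"
  shows "restr h J K (restr h I J a) = restr h I K a"
proof -
  have "act h K I (id \<circ> id) a = act h K J id (act h J I id a)"
    using assms by (intro act_comp id_in_injections) (auto intro: finite_subset)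
  then show ?thesis
    by (simp add: restr_def)
qed

lemma equiv_iso_rel: "equiv (objects h) (iso_rel h)"
proof (rule equivI)
  show "iso_rel h \<subseteq> objects h \<times> objects h"
    by (auto simp: iso_rel_def objects_def)
  show "refl_on (objects h) (iso_rel h)"
    unfolding refl_on_def iso_rel_def objects_def using act_id bij_betw_id by blast
  show "sym (iso_rel h)"
  proof (rule symI, clarify)
    fix I a J b assume "((I, a), (J, b)) \<in> iso_rel h"
    then obtain \<phi> where *: "finite I" "finite J" "a \<in> obj h I" "b \<in> obj h J" "bij_betw \<phi> I J"
      "act h I J \<phi> b = a"
      by (auto simp: iso_rel_def)
    let ?\<psi> = "inv_into I \<phi>"
    have \<psi>: "bij_betw ?\<psi> J I"
      using * by (simp add: bij_betw_inv_into)
    have "act h J I ?\<psi> a = act h J J (\<phi> \<circ> ?\<psi>) b"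
      using * act_comp[OF _ _ _ bij_betw_in_injections[OF \<psi>] bij_betw_in_injections[OF *(5)] *(4)]
      by simp
    \<comment> \<open>The composite is the identity on \<open>J\<close> only, hence the appeal to
      \<open>act_cong\<close>.\<close>
    also have "\<dots> = act h J J id b"
    proof (rule act_cong)
      show "\<phi> \<circ> ?\<psi> \<in> injections J J"
        using bij_betw_trans[OF \<psi> *(5)] by (rule bij_betw_in_injections)
      show "(\<phi> \<circ> ?\<psi>) i = id i" if "i \<in> J" for i
        using *(5) that by (simp add: bij_betw_inv_into_right)
    qed (use * in auto)
    finally show "((J, b), (I, a)) \<in> iso_rel h"
      using * \<psi> act_id by (auto simp: iso_rel_def)
  qed
  show "trans (iso_rel h)"
  proof (rule transI, clarify)
    fix I a J b K c
    assume "((I, a), (J, b)) \<in> iso_rel h" "((J, b), (K, c)) \<in> iso_rel h"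
    then obtain \<phi> \<psi> where *: "finite I" "finite J" "finite K" "a \<in> obj h I" "b \<in> obj h J"
      "c \<in> obj h K" "bij_betw \<phi> I J" "act h I J \<phi> b = a" "bij_betw \<psi> J K" "act h J K \<psi> c = b"
      by (auto simp: iso_rel_def)
    have "act h I K (\<psi> \<circ> \<phi>) c = a"
      using act_comp[OF *(1-3) bij_betw_in_injections[OF *(7)] bij_betw_in_injections[OF *(9)] *(6)] *
      by simp
    with * bij_betw_trans[OF *(7,9)] show "((I, a), (K, c)) \<in> iso_rel h"
      by (auto simp: iso_rel_def)
  qed
qed

lemma class_of_eq_iff:
  assumes "finite I" "a \<in> obj h I" "finite J" "b \<in> obj h J"
  shows "class_of h I a = class_of h J b \<longleftrightarrow> (\<exists>\<phi>. bij_betw \<phi> I J \<and> act h I J \<phi> b = a)"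
proof -
  have "class_of h I a = class_of h J b \<longleftrightarrow> ((I, a), (J, b)) \<in> iso_rel h"
    unfolding class_of_def using assms by (intro eq_equiv_class_iff[OF equiv_iso_rel]) (auto simp: objects_def)
  with assms show ?thesis
    by (simp add: iso_rel_def)
qed

lemma mem_class_of_iff:
  assumes "finite I" "a \<in> obj h I"
  shows "(J, b) \<in> class_of h I a \<longleftrightarrow> finite J \<and> b \<in> obj h J \<and> class_of h J b = class_of h I a"
  using equiv_class_eq_iff[OF equiv_iso_rel, of "(I, a)" "(J, b)"] assms
  by (auto simp: class_of_def objects_def)

lemma self_mem_class_of: "\<lbrakk>finite I; a \<in> obj h I\<rbrakk> \<Longrightarrow> (I, a) \<in> class_of h I a"
  by (simp add: mem_class_of_iff)

text \<open>\<open>class_map\<close> and \<open>class_mult\<close> are images of the set of results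
  over all representatives. Their well-definedness reduces to showing that these results lie in a
  single class.\<close>

lemma Image_class_of:
  assumes "finite I" "a \<in> obj h I" "S \<subseteq> class_of h I a" "S \<noteq> {}"
  shows "iso_rel h `` S = class_of h I a"
proof -
  have "iso_rel h `` {x} = class_of h I a" if "x \<in> S" for x
    using that assms mem_class_of_iff[OF assms(1,2)] by (cases x) (auto simp: class_of_def)
  then show ?thesis
    using assms(4) by blast
qed

lemma class_of_card:
  assumes "finite I" "a \<in> obj h I"
  obtains b where "b \<in> obj h {1..card I}" "class_of h I a = class_of h {1..card I} b"
proof -
  obtain \<phi> where \<phi>: "bij_betw \<phi> {1..card I} I"
    using ex_bij_betw_nat_finite_1[OF assms(1)] by blast
  let ?b = "act h {1..card I} I \<phi> a"
  have b: "?b \<in> obj h {1..card I}"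
    using \<phi> assms by (intro act_obj_bij) auto
  moreover have "class_of h {1..card I} ?b = class_of h I a"
    using \<phi> assms b by (subst class_of_eq_iff) auto
  ultimately show ?thesis
    using that by metis
qed

lemma iso_classes_iff: "B \<in> \<G> h \<longleftrightarrow> (\<exists>I a. finite I \<and> a \<in> obj h I \<and> B = class_of h I a)"
proof
  assume "B \<in> \<G> h"
  then obtain n a where "a \<in> obj h {1..n::nat}" "B = class_of h {1..n} a"
    by (auto simp: iso_classes_def quotient_def class_of_def)
  then show "\<exists>I a. finite I \<and> a \<in> obj h I \<and> B = class_of h I a"
    by blast
next
  assume "\<exists>I a. finite I \<and> a \<in> obj h I \<and> B = class_of h I a"
  then obtain n b where "b \<in> obj h {1..n::nat}" "B = class_of h {1..n} b"
    by (metis class_of_card)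
  then show "B \<in> \<G> h"
    by (auto simp: iso_classes_def quotient_def class_of_def)
qed

lemma iso_classesE:
  assumes "B \<in> \<G> h"
  obtains I a where "finite I" "a \<in> obj h I" "B = class_of h I a"
  using assms iso_classes_iff by blast

lemma class_of_in [simp]: "\<lbrakk>finite I; a \<in> obj h I\<rbrakk> \<Longrightarrow> class_of h I a \<in> \<G> h"
  using iso_classes_iff by blast

lemma SOME_class_of:
  assumes "finite I" "a \<in> obj h I"
  obtains J b where "(SOME x. x \<in> class_of h I a) = (J, b)" "finite J" "b \<in> obj h J"
    "class_of h J b = class_of h I a"
proof -
  have "(SOME x. x \<in> class_of h I a) \<in> class_of h I a"
    using self_mem_class_of[OF assms] by (rule someI)
  with mem_class_of_iff[OF assms] that show ?thesis
    by (cases "SOME x. x \<in> class_of h I a") auto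
qed

lemma class_size_class_of [simp]:
  assumes "finite I" "a \<in> obj h I"
  shows "class_size (class_of h I a) = card I"
proof -
  obtain J b where *: "(SOME x. x \<in> class_of h I a) = (J, b)" "finite J" "b \<in> obj h J"
    "class_of h J b = class_of h I a"
    using SOME_class_of[OF assms] .
  then have "card J = card I"
    using class_of_eq_iff[of J b I a] assms by (auto intro: bij_betw_same_card)
  then show ?thesis
    by (simp add: class_size_def *(1))
qed

lemma iso_classes_size_obtain:
  assumes "B \<in> \<G> h"
  obtains b where "b \<in> obj h {1..class_size B}" "B = class_of h {1..class_size B} b"
proof -
  obtain I a where *: "finite I" "a \<in> obj h I" "B = class_of h I a"
    using assms by (rule iso_classesE)
  then show ?thesis
    using class_of_card[OF *(1,2)] that by auto
qed

text \<open>A class of size \<open>k\<close> is represented on \<open>{1..k}\<close>, where there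
  are finitely many objects. Fibres of \<open>class_map\<close> and factorizations of a class have
  bounded size, so this makes the sums over them finite.\<close>

lemma finite_iso_classes_le: "finite {B \<in> \<G> h. class_size B \<le> n}"
proof (rule finite_subset)
  show "{B \<in> \<G> h. class_size B \<le> n} \<subseteq> (\<Union>k\<le>n. class_of h {1..k} ` obj h {1..k})"
    by (fastforce elim: iso_classes_size_obtain)
  show "finite (\<Union>k\<le>n. class_of h {1..k} ` obj h {1..k})"
    by (auto intro: finite_obj)
qed

section \<open>Patterns of an object and pattern functions\<close>

lemma pattern_at_in [simp]:
  "\<lbrakk>finite I; a \<in> obj h I; J \<subseteq> I\<rbrakk> \<Longrightarrow> pattern_at h I a J \<in> \<G> h"
  unfolding pattern_at_def by (auto intro!: class_of_in restr_closed intro: finite_subset)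

lemma class_size_pattern_at [simp]:
  assumes "finite I" "a \<in> obj h I" "J \<subseteq> I"
  shows "class_size (pattern_at h I a J) = card J"
  unfolding pattern_at_def using assms
  by (intro class_size_class_of restr_closed) (auto intro: finite_subset)

lemma pattern_at_self [simp]:
  "\<lbrakk>finite I; a \<in> obj h I\<rbrakk> \<Longrightarrow> pattern_at h I a I = class_of h I a"
  by (simp add: pattern_at_def restr_def act_id)

lemma pattern_at_restr:
  "\<lbrakk>finite I; J \<subseteq> I; K \<subseteq> J; a \<in> obj h I\<rbrakk> \<Longrightarrow> pattern_at h J (restr h I J a) K = pattern_at h I a K"
  by (simp add: pattern_at_def restr_restr)

text \<open>Restricting after relabeling and relabeling after restricting are both the action of the
  same injection from \<open>J\<close> to \<open>I'\<close>.\<close>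

lemma pattern_at_bij:
  assumes "finite I" "finite I'" "bij_betw \<phi> I I'" "b \<in> obj h I'" "J \<subseteq> I"
  shows "pattern_at h I (act h I I' \<phi> b) J = pattern_at h I' b (\<phi> ` J)"
proof -
  let ?J' = "\<phi> ` J"
  have J: "finite J" "finite ?J'" "?J' \<subseteq> I'" and bij: "bij_betw \<phi> J ?J'"
    using assms by (auto simp: bij_betw_def intro: finite_subset inj_on_subset)
  note inj = bij_betw_in_injections[OF assms(3)]
  have "act h J ?J' \<phi> (act h ?J' I' id b) = act h J I' (id \<circ> \<phi>) b"
    using J assms bij_betw_in_injections[OF bij] by (intro act_comp[symmetric] id_in_injections) auto
  also have "\<dots> = act h J I id (act h I I' \<phi> b)"
    using J assms inj by (subst act_comp[symmetric]) (auto intro: id_in_injections)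
  finally have "act h J ?J' \<phi> (restr h I' ?J' b) = restr h I J (act h I I' \<phi> b)"
    by (simp add: restr_def)
  then show ?thesis
    unfolding pattern_at_def using J bij assms act_obj_bij[OF assms(1-4)]
    by (subst class_of_eq_iff) (auto intro!: restr_closed)
qed

lemma class_of_eqE:
  assumes "finite I" "a \<in> obj h I" "finite I'" "b \<in> obj h I'" "class_of h I a = class_of h I' b"
  obtains \<phi> where "bij_betw \<phi> I I'"
    "\<And>J. J \<subseteq> I \<Longrightarrow> pattern_at h I a J = pattern_at h I' b (\<phi> ` J)"
  using class_of_eq_iff[OF assms(1-4)] assms pattern_at_bij by metis

lemma pattern_fun_outside: "B \<notin> \<G> h \<Longrightarrow> pattern_fun h a B = 0"
  by (simp add: pattern_fun_def)

lemma card_pattern_at_cong: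
  assumes "finite I" "b \<in> obj h I" "finite I'" "b' \<in> obj h I'" "class_of h I b = class_of h I' b'"
  shows "card {J. J \<subseteq> I \<and> pattern_at h I b J = a} = card {J. J \<subseteq> I' \<and> pattern_at h I' b' J = a}"
proof -
  obtain \<phi> where \<phi>: "bij_betw \<phi> I I'"
    "\<And>J. J \<subseteq> I \<Longrightarrow> pattern_at h I b J = pattern_at h I' b' (\<phi> ` J)"
    by (rule class_of_eqE[OF assms]) auto
  have "bij_betw (image \<phi>) {J \<in> Pow I. pattern_at h I b J = a} {J \<in> Pow I'. pattern_at h I' b' J = a}"
    by (rule bij_betw_Collect[OF bij_betw_Pow[OF \<phi>(1)]]) (simp add: \<phi>(2))
  then show ?thesis
    by (simp add: bij_betw_same_card)
qed

text \<open>Replaces the \<open>SOME\<close> representative in \<open>pattern_fun\<close> by any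
  given one: a relabeling carries the occurrences of \<open>a\<close> in one bijectively to those in
  the other.\<close>

lemma pattern_fun_card:
  assumes a: "a \<in> \<G> h" and I: "finite I" "b \<in> obj h I"
  shows "pattern_fun h a (class_of h I b) = of_nat (card {J. J \<subseteq> I \<and> pattern_at h I b J = a})"
proof -
  obtain I' b' where *: "(SOME x. x \<in> class_of h I b) = (I', b')" "finite I'" "b' \<in> obj h I'"
    "class_of h I' b' = class_of h I b"
    using SOME_class_of[OF I] .
  have "(J, restr h I' J b') \<in> a \<longleftrightarrow> pattern_at h I' b' J = a" if "J \<subseteq> I'" for J
    using a that * mem_class_of_iff finite_subset[OF that *(2)] restr_closed[OF *(2) that *(3)]
    unfolding pattern_at_def by (metis iso_classesE)
  then have "pattern_count h a (I', b') = card {J. J \<subseteq> I' \<and> pattern_at h I' b' J = a}"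
    unfolding pattern_count_def by (auto intro: arg_cong[where f = card])
  also have "\<dots> = card {J. J \<subseteq> I \<and> pattern_at h I b J = a}"
    using * I by (intro card_pattern_at_cong) auto
  finally show ?thesis
    using I by (simp add: pattern_fun_def *(1))
qed

lemma pattern_fun_sum:
  assumes "a \<in> \<G> h" "finite I" "b \<in> obj h I"
  shows "pattern_fun h a (class_of h I b) = (\<Sum>J\<in>Pow I. if pattern_at h I b J = a then 1 else 0)"
proof -
  have "{J. J \<subseteq> I \<and> pattern_at h I b J = a} = {J \<in> Pow I. pattern_at h I b J = a}"
    by auto
  then show ?thesis
    using assms(2) by (simp add: pattern_fun_card[OF assms] sum.inter_filter[symmetric])
qed

text \<open>Triangularity with respect to size: an occurrence of \<open>a\<close> on a proper subset
  makes \<open>a\<close> smaller than \<open>B\<close>, and one on the full label set makes them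
  equal.\<close>

lemma pattern_fun_neq_0:
  assumes a: "a \<in> \<G> h" and neq: "pattern_fun h a B \<noteq> 0"
  shows "class_size a < class_size B \<or> a = B"
proof -
  have "B \<in> \<G> h"
    using neq pattern_fun_outside by blast
  then obtain I b where b: "finite I" "b \<in> obj h I" "B = class_of h I b"
    by (rule iso_classesE)
  with neq a have "{J. J \<subseteq> I \<and> pattern_at h I b J = a} \<noteq> {}"
    by (auto simp: pattern_fun_card)
  then obtain J where J: "J \<subseteq> I" "pattern_at h I b J = a"
    by blast
  show ?thesis
  proof (cases "J = I")
    case False
    then have "card J < card I"
      using J b by (simp add: psubset_card_mono psubsetI)
    then show ?thesis
      using J b by auto
  qed (use J b in simp)
qed

lemma pattern_fun_self: "a \<in> \<G> h \<Longrightarrow> pattern_fun h a a = 1"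
proof -
  assume a: "a \<in> \<G> h"
  then obtain I b where b: "finite I" "b \<in> obj h I" "a = class_of h I b"
    by (rule iso_classesE)
  have "J = I" if "J \<subseteq> I" "pattern_at h I b J = a" for J
    using that b class_size_pattern_at[OF b(1,2) that(1)] card_subset_eq[OF b(1)] by simp
  then have "{J. J \<subseteq> I \<and> pattern_at h I b J = a} = {I}"
    using b by auto
  then show ?thesis
    using pattern_fun_card[OF a b(1,2)] b(3) by simp
qed

text \<open>Evaluating a vanishing combination at a class of minimal size isolates its coefficient.\<close>

lemma pattern_fun_independent:
  shows "inj_on (pattern_fun h) (\<G> h)" and "fs.independent (pattern_fun h ` \<G> h)"
proof -
  show inj: "inj_on (pattern_fun h) (\<G> h)"
  proof (rule inj_onI)
    fix a b assume "a \<in> \<G> h" "b \<in> \<G> h" and eq: "pattern_fun h a = pattern_fun h b"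
    then have "pattern_fun h a b \<noteq> 0" "pattern_fun h b a \<noteq> 0"
      using pattern_fun_self by (metis zero_neq_one)+
    then show "a = b"
      using pattern_fun_neq_0 \<open>a \<in> \<G> h\<close> \<open>b \<in> \<G> h\<close> by (metis less_asym)
  qed
  show "fs.independent (pattern_fun h ` \<G> h)"
    unfolding fs.dependent_explicit
  proof clarify
    fix t u v
    assume t: "finite t" "t \<subseteq> pattern_fun h ` \<G> h"
      and v: "v \<in> t" "u v \<noteq> 0" and zero: "(\<Sum>p\<in>t. fscale (u p) p) = 0"
    obtain T where T: "T \<subseteq> \<G> h" "finite T" "t = pattern_fun h ` T"
      using finite_subset_image[OF t] by metis
    let ?N = "{a \<in> T. u (pattern_fun h a) \<noteq> 0}"
    obtain a where a: "is_arg_min class_size (\<lambda>a. a \<in> ?N) a"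
      using ex_is_arg_min_if_finite[of ?N class_size] T v by auto
    then have aN: "a \<in> T" "u (pattern_fun h a) \<noteq> 0"
      by (auto simp: is_arg_min_def)
    have "0 = (\<Sum>p\<in>t. fscale (u p) p) a"
      by (simp add: zero)
    also have "\<dots> = (\<Sum>b\<in>T. u (pattern_fun h b) * pattern_fun h b a)"
      by (simp add: T(3) sum.reindex[OF inj_on_subset[OF inj T(1)]] sum_fun_apply fscale_def)
    also have "\<dots> = (\<Sum>b\<in>T. if b = a then u (pattern_fun h a) else 0)"
    proof (rule sum.cong)
      fix b assume "b \<in> T"
      then show "u (pattern_fun h b) * pattern_fun h b a = (if b = a then u (pattern_fun h a) else 0)"
        using a T(1) pattern_fun_neq_0[of b a] pattern_fun_self[of b]
        by (auto simp: is_arg_min_def)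
    qed simp
    finally show False
      using aN T(2) by simp
  qed
qed

end

section \<open>The pattern algebra\<close>

context combinatorial_presheaf
begin

lemma pattern_space_outside:
  assumes "F \<in> \<A> h" "B \<notin> \<G> h"
  shows "F B = 0"
proof -
  have "fs.subspace {F. F B = 0}"
    by (auto simp: fs.subspace_def fscale_def)
  then have "\<A> h \<subseteq> {F. F B = 0}"
    unfolding pattern_space_def using pattern_fun_outside[OF assms(2)]
    by (intro fs.span_minimal) auto
  with assms(1) show ?thesis
    by auto
qed

lemma pattern_fun_in: "a \<in> \<G> h \<Longrightarrow> pattern_fun h a \<in> \<A> h"
  unfolding pattern_space_def by (simp add: fs.span_base)

lemma subspace_pattern_space: "fs.subspace (\<A> h)"
  by (simp add: pattern_space_def)

text \<open>
  A sum over all patterns is easier to recognize than a combination of pattern functions: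
  the product of two pattern functions becomes a sum over pairs of sets covering each pattern.
\<close>

lemma pattern_spaceI:
  assumes outside: "\<And>B. B \<notin> \<G> h \<Longrightarrow> F B = 0"
    and inside: "\<And>I x. finite I \<Longrightarrow> x \<in> obj h I \<Longrightarrow>
      F (class_of h I x) = (\<Sum>J\<in>Pow I. w (pattern_at h I x J))"
    and bound: "\<And>B. B \<in> \<G> h \<Longrightarrow> w B \<noteq> 0 \<Longrightarrow> class_size B \<le> n"
  shows "F \<in> \<A> h"
proof -
  \<comment> \<open>The values of \<open>w\<close> serve as coefficients, and the size bound keeps
    the combination finite. After exchanging sums, each \<open>J\<close> picks out the single class
    \<open>pattern_at h I x J\<close>.\<close>
  let ?D = "{a \<in> \<G> h. class_size a \<le> n}"
  have "F = (\<Sum>a\<in>?D. fscale (w a) (pattern_fun h a))"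
  proof
    fix B
    show "F B = (\<Sum>a\<in>?D. fscale (w a) (pattern_fun h a)) B"
    proof (cases "B \<in> \<G> h")
      case False
      then show ?thesis
        by (simp add: sum_fun_apply fscale_def outside pattern_fun_outside)
    next
      case True
      then obtain I x where I: "finite I" "x \<in> obj h I" and B: "B = class_of h I x"
        by (rule iso_classesE)
      have "(\<Sum>a\<in>?D. fscale (w a) (pattern_fun h a)) B
          = (\<Sum>a\<in>?D. \<Sum>J\<in>Pow I. if a = pattern_at h I x J then w a else 0)"
        unfolding sum_fun_apply fscale_def
        by (rule sum.cong) (auto simp: B pattern_fun_sum I sum_distrib_left intro!: sum.cong)
      also have "\<dots> = (\<Sum>J\<in>Pow I. \<Sum>a\<in>?D. if a = pattern_at h I x J then w a else 0)"
        by (rule sum.swap)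
      also have "\<dots> = (\<Sum>J\<in>Pow I. w (pattern_at h I x J))"
      proof (rule sum.cong)
        fix J assume "J \<in> Pow I"
        then have "pattern_at h I x J \<in> \<G> h"
          using I by simp
        then show "(\<Sum>a\<in>?D. if a = pattern_at h I x J then w a else 0) = w (pattern_at h I x J)"
          using bound by (auto simp: sum.delta'[OF finite_iso_classes_le] sum.delta[OF finite_iso_classes_le])
      qed simp
      finally show ?thesis
        by (simp add: inside I B)
    qed
  qed
  also have "\<dots> \<in> \<A> h"
    by (intro fs.subspace_sum fs.subspace_scale subspace_pattern_space pattern_fun_in) auto
  finally show ?thesis .
qed

text \<open>Every label set has exactly one subset of size 0, so the constant 1 is the sum of the
  pattern functions of all classes of size 0; without connectedness there may be several of
  them.\<close>

lemma unit_in_pattern_space: "(\<lambda>B. if B \<in> \<G> h then 1 else 0) \<in> \<A> h"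
proof (rule pattern_spaceI[where w = "\<lambda>B. if class_size B = 0 then 1 else 0" and n = 0])
  fix I x assume I: "finite I" "x \<in> obj h I"
  have "(\<Sum>J\<in>Pow I. if class_size (pattern_at h I x J) = 0 then 1 else 0)
      = (\<Sum>J\<in>Pow I. if J = {} then 1 else 0 :: rat)"
  proof (rule sum.cong)
    fix J assume "J \<in> Pow I"
    with I finite_subset[of J I] show "(if class_size (pattern_at h I x J) = 0 then 1 else 0)
        = (if J = {} then 1 else 0 :: rat)"
      by simp
  qed simp
  also have "\<dots> = 1"
    using I by simp
  finally show "(if class_of h I x \<in> \<G> h then 1 else 0)
      = (\<Sum>J\<in>Pow I. if class_size (pattern_at h I x J) = 0 then 1 else 0 :: rat)"
    using I by simp
qed (auto split: if_splits)

text \<open>The product counts pairs of an occurrence of \<open>a\<close> and an occurrence of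
  \<open>b\<close>. Grouping the pairs by their union gives a combination whose coefficient at a
  class is the number of ways to cover its representative by such a pair.\<close>

lemma pattern_fun_mult_in:
  assumes a: "a \<in> \<G> h" and b: "b \<in> \<G> h"
  shows "pattern_fun h a * pattern_fun h b \<in> \<A> h"
proof -
  define cov where "cov = (\<lambda>I x. {p \<in> Pow I \<times> Pow I. fst p \<union> snd p = I \<and>
    pattern_at h I x (fst p) = a \<and> pattern_at h I x (snd p) = b})"
  define w :: "'a iso_class \<Rightarrow> rat" where
    "w = (\<lambda>B. case SOME x. x \<in> B of (I, x) \<Rightarrow> of_nat (card (cov I x)))"
  \<comment> \<open>A relabeling transports coverings, so \<open>w\<close> does not depend on the
    representative that \<open>SOME\<close> selects.\<close>
  have cov_cong: "card (cov I x) = card (cov I' x')"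
    if eq: "finite I" "x \<in> obj h I" "finite I'" "x' \<in> obj h I'" "class_of h I x = class_of h I' x'"
    for I x I' x'
  proof -
    obtain \<phi> where \<phi>: "bij_betw \<phi> I I'"
      "\<And>J. J \<subseteq> I \<Longrightarrow> pattern_at h I x J = pattern_at h I' x' (\<phi> ` J)"
      by (rule class_of_eqE[OF eq]) blast
    have cover: "\<phi> ` J \<union> \<phi> ` K = I' \<longleftrightarrow> J \<union> K = I" if "J \<subseteq> I" "K \<subseteq> I" for J K
      using that \<phi>(1) inj_on_image_eq_iff[of \<phi> I "J \<union> K" I]
      by (simp add: bij_betw_def image_Un[symmetric])
    have "bij_betw (map_prod (image \<phi>) (image \<phi>)) (cov I x) (cov I' x')"
      unfolding cov_def
      by (rule bij_betw_Collect[OF bij_betw_map_prod[OF bij_betw_Pow bij_betw_Pow, OF \<phi>(1) \<phi>(1)]])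
        (elim SigmaE, simp add: \<phi>(2) cover)
    then show ?thesis
      by (rule bij_betw_same_card)
  qed
  have w: "w (class_of h I x) = of_nat (card (cov I x))" if I: "finite I" "x \<in> obj h I" for I x
  proof -
    obtain I' x' where *: "(SOME y. y \<in> class_of h I x) = (I', x')" "finite I'" "x' \<in> obj h I'"
      "class_of h I' x' = class_of h I x"
      using SOME_class_of[OF I] .
    then show ?thesis
      by (simp add: w_def cov_cong[OF *(2,3) I *(4)])
  qed
  show ?thesis
  proof (rule pattern_spaceI)
    fix I x assume I: "finite I" "x \<in> obj h I"
    let ?A = "\<lambda>a. {J. J \<subseteq> I \<and> pattern_at h I x J = a}"
    have fin: "finite (?A a)" "finite (?A b)"
      using I by auto
    have "(\<Sum>J\<in>Pow I. w (pattern_at h I x J))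
        = (\<Sum>U\<in>Pow I. \<Sum>p\<in>{p \<in> ?A a \<times> ?A b. fst p \<union> snd p = U}. 1)"
    proof (rule sum.cong)
      fix U assume "U \<in> Pow I"
      then have U: "U \<subseteq> I" "finite U" "restr h I U x \<in> obj h U"
        using I by (auto intro: finite_subset restr_closed)
      have "w (pattern_at h I x U) = of_nat (card (cov U (restr h I U x)))"
        unfolding pattern_at_def using U by (simp add: w)
      moreover have "cov U (restr h I U x) = {p \<in> ?A a \<times> ?A b. fst p \<union> snd p = U}"
        unfolding cov_def using U I by (auto simp: pattern_at_restr)
      ultimately show "w (pattern_at h I x U)
          = (\<Sum>p\<in>{p \<in> ?A a \<times> ?A b. fst p \<union> snd p = U}. 1)"
        by simp
    qed simp
    also have "\<dots> = (\<Sum>p\<in>?A a \<times> ?A b. 1)"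
      by (rule sum.group) (use I fin in auto)
    finally show "(pattern_fun h a * pattern_fun h b) (class_of h I x)
        = (\<Sum>J\<in>Pow I. w (pattern_at h I x J))"
      using fin by (simp add: pattern_fun_card a b I card_cartesian_product)
  next
    fix B assume "B \<in> \<G> h" and neq: "w B \<noteq> 0"
    then obtain I x where I: "finite I" "x \<in> obj h I" and B: "B = class_of h I x"
      by (meson iso_classesE)
    with neq w have "cov I x \<noteq> {}"
      by auto
    then obtain J K where *: "J \<subseteq> I" "K \<subseteq> I" "J \<union> K = I" "pattern_at h I x J = a" "pattern_at h I x K = b"
      by (auto simp: cov_def)
    \<comment> \<open>A covered label set is no larger than its two pieces together, which bounds
      the support of \<open>w\<close>.\<close>
    then have "card I \<le> card J + card K"
      using card_Un_le by metis
    with * show "class_size B \<le> class_size a + class_size b"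
      using I B by auto
  qed (simp add: pattern_fun_outside)
qed

lemma pattern_space_mult:
  assumes F: "F \<in> \<A> h" and G: "G \<in> \<A> h"
  shows "F * G \<in> \<A> h"
proof -
  have lin: "linear_on fscale V (\<lambda>F. F * G)" for V and G :: "'a iso_class \<Rightarrow> rat"
    by (auto simp: linear_on_def fscale_def algebra_simps)
  note span = linear_on_span_into[OF lin subspace_pattern_space]
  \<comment> \<open>Closure passes from generators to the span in one factor at a time;
    commutativity swaps the factors in between.\<close>
  have "F * pattern_fun h b \<in> \<A> h" if "b \<in> \<G> h" for b
    using span[of "pattern_fun h ` \<G> h" "pattern_fun h b" F] F that pattern_fun_mult_in
    unfolding pattern_space_def[symmetric] by auto
  then have "G' * F \<in> \<A> h" if "G' \<in> pattern_fun h ` \<G> h" for G'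
    using that by (auto simp: mult.commute)
  then have "G * F \<in> \<A> h"
    using span[of "pattern_fun h ` \<G> h" F G] G unfolding pattern_space_def[symmetric] by blast
  then show ?thesis
    by (simp add: mult.commute)
qed

end


section \<open>Morphisms of presheaves\<close>

locale combinatorial_presheaf_morphism =
  h: combinatorial_presheaf h + j: combinatorial_presheaf j + presheaf_morphism h j f
  for h :: "'a presheaf" and j :: "'b presheaf" and f
begin

text \<open>Naturality along bijections makes the images of all representatives isomorphic.\<close>

lemma class_map_class_of:
  assumes "finite I" "a \<in> obj h I"
  shows "class_map j f (class_of h I a) = class_of j I (f I a)"
  unfolding class_map_def
proof (rule j.Image_class_of)
  show "(\<lambda>(I, a). (I, f I a)) ` class_of h I a \<subseteq> class_of j I (f I a)"
  proof clarify
    fix J b assume "(J, b) \<in> class_of h I a"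
    then have J: "finite J" "b \<in> obj h J" and "class_of h J b = class_of h I a"
      by (auto simp: h.mem_class_of_iff assms)
    then obtain \<phi> where \<phi>: "bij_betw \<phi> J I" "act h J I \<phi> a = b"
      using h.class_of_eq_iff[OF J assms] by blast
    then have "f J b = act j J I \<phi> (f I a)"
      using mor_natural[OF J(1) assms(1) bij_betw_in_injections[OF \<phi>(1)] assms(2)] by simp
    then have "class_of j J (f J b) = class_of j I (f I a)"
      using J assms \<phi>(1) j.class_of_eq_iff[OF J(1) mor_closed[OF J] assms(1) mor_closed[OF assms]]
      by auto
    then show "(J, f J b) \<in> class_of j I (f I a)"
      using J assms by (simp add: j.mem_class_of_iff mor_closed)
  qed
qed (use assms h.self_mem_class_of[OF assms] mor_closed in auto)

lemma class_map_in [simp]: "B \<in> \<G> h \<Longrightarrow> class_map j f B \<in> \<G> j"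
  by (auto simp: class_map_class_of mor_closed elim!: h.iso_classesE)

lemma class_size_class_map [simp]: "B \<in> \<G> h \<Longrightarrow> class_size (class_map j f B) = class_size B"
  by (auto simp: class_map_class_of mor_closed elim!: h.iso_classesE)

text \<open>Naturality along the inclusion of \<open>J\<close>: the morphism commutes with
  restriction.\<close>

lemma pattern_at_class_map:
  assumes "finite I" "a \<in> obj h I" "J \<subseteq> I"
  shows "pattern_at j I (f I a) J = class_map j f (pattern_at h I a J)"
proof -
  have J: "finite J"
    using assms finite_subset by blast
  then have "f J (restr h I J a) = restr j I J (f I a)"
    unfolding restr_def using mor_natural[OF J assms(1) id_in_injections[OF assms(3)] assms(2)] by simp
  then show ?thesis
    using class_map_class_of[OF J h.restr_closed[OF assms(1,3,2)]] by (simp add: pattern_at_def)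
qed

lemma finite_fibre: "finite {b \<in> \<G> h. class_map j f b = a}"
  by (rule finite_subset[OF _ h.finite_iso_classes_le[of "class_size a"]]) auto

lemma pattern_fun_class_map:
  assumes a: "a \<in> \<G> j" and B: "B \<in> \<G> h"
  shows "pattern_fun j a (class_map j f B) = (\<Sum>b\<in>{b \<in> \<G> h. class_map j f b = a}. pattern_fun h b B)"
proof -
  let ?fib = "{b \<in> \<G> h. class_map j f b = a}"
  obtain I x where I: "finite I" "x \<in> obj h I" "B = class_of h I x"
    using B by (rule h.iso_classesE)
  have "(\<Sum>b\<in>?fib. pattern_fun h b B)
      = (\<Sum>b\<in>?fib. \<Sum>J\<in>Pow I. if pattern_at h I x J = b then 1 else 0)"
    by (rule sum.cong) (auto simp: I h.pattern_fun_sum)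
  also have "\<dots> = (\<Sum>J\<in>Pow I. \<Sum>b\<in>?fib. if pattern_at h I x J = b then 1 else 0)"
    by (rule sum.swap)
  \<comment> \<open>Each \<open>J\<close> has one pattern in \<open>h\<close>, and it is counted
    exactly when that pattern lies in the fibre over \<open>a\<close>.\<close>
  also have "\<dots> = (\<Sum>J\<in>Pow I. if pattern_at j I (f I x) J = a then 1 else 0)"
    using I by (intro sum.cong) (auto simp: sum.delta'[OF finite_fibre] pattern_at_class_map)
  also have "\<dots> = pattern_fun j a (class_of j I (f I x))"
    using a I by (simp add: j.pattern_fun_sum mor_closed)
  finally show ?thesis
    using I by (simp add: class_map_class_of)
qed

section \<open>The map on pattern algebras as a pullback\<close>

abbreviation "pull \<equiv> pullback (\<G> h) (class_map j f)"

lemma pull_pattern_fun: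
  "a \<in> \<G> j \<Longrightarrow> pull (pattern_fun j a) = (\<Sum>b\<in>{b \<in> \<G> h. class_map j f b = a}. pattern_fun h b)"
  by (auto simp: fun_eq_iff pullback_def sum_fun_apply pattern_fun_class_map h.pattern_fun_outside)

lemma pull_in:
  assumes "F \<in> \<A> j"
  shows "pull F \<in> \<A> h"
proof (rule linear_on_span_into[OF linear_on_pullback h.subspace_pattern_space])
  show "F \<in> fs.span (pattern_fun j ` \<G> j)"
    using assms by (simp add: pattern_space_def)
  show "pull G \<in> \<A> h" if "G \<in> pattern_fun j ` \<G> j" for G
    using that by (auto simp only: pull_pattern_fun intro!: fs.subspace_sum h.subspace_pattern_space h.pattern_fun_in)
qed

lemma is_pattern_map_iff: "is_pattern_map h j f L \<longleftrightarrow> L = restrict pull (\<A> j)"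
  unfolding is_pattern_map_def
  by (rule is_linear_extension_iff[OF pattern_space_def linear_on_pullback pull_in pull_pattern_fun])

lemma pattern_map_eq: "pattern_map h j f = restrict pull (\<A> j)"
  unfolding pattern_map_def by (rule the_equality) (simp_all only: is_pattern_map_iff)

lemma pattern_map_linear: "pattern_map h j f \<in> linear_maps fscale fscale (\<A> j) (\<A> h)"
  unfolding pattern_map_eq
  by (intro restrict_in_linear_maps linear_on_pullback j.subspace_pattern_space pull_in)

lemma algebra_morphism_pattern_map:
  "algebra_morphism (pattern_algebra j) (pattern_algebra h) (pattern_map h j f)"
  unfolding algebra_morphism_def
proof (intro conjI ballI)
  show "pattern_map h j f \<in> linear_maps fscale fscale (carr (pattern_algebra j)) (carr (pattern_algebra h))"
    by (simp add: pattern_algebra_def pattern_map_linear)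
  show "pattern_map h j f (F * G) = pattern_map h j f F * pattern_map h j f G"
    if "F \<in> carr (pattern_algebra j)" "G \<in> carr (pattern_algebra j)" for F G
    \<comment> \<open>The map is \<open>undefined\<close> off the pattern space, so
      \<open>F * G\<close> must be known to lie in it before the pointwise computation
      applies.\<close>
    using that j.pattern_space_mult[of F G]
    by (auto simp: pattern_algebra_def pattern_map_eq pullback_def fun_eq_iff)
  show "pattern_map h j f (unt (pattern_algebra j)) = unt (pattern_algebra h)"
    using j.unit_in_pattern_space
    by (auto simp: pattern_algebra_def pattern_map_eq pullback_def fun_eq_iff)
qed

end

section \<open>The pattern bialgebra\<close>

context associative_presheaf
begin

abbreviation "mul \<equiv> class_mult h m"
abbreviation "unit \<equiv> class_unit h e"

lemma class_unit_eq: "unit = class_of h {} e"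
  by (simp add: class_unit_def class_of_def)

text \<open>Disjointness lets relabelings of the two factors be glued to one bijection
  \<open>\<chi>\<close> of the unions, and \<open>prod_natural\<close> carries the product along
  it.\<close>

lemma class_mult_class_of:
  assumes I: "finite I" "a \<in> obj h I" and J: "finite J" "b \<in> obj h J" and disj: "I \<inter> J = {}"
  shows "mul (class_of h I a) (class_of h J b) = class_of h (I \<union> J) (m I J a b)"
  unfolding class_mult_def
proof (rule Image_class_of)
  have fin: "finite (I \<union> J)" and ab: "m I J a b \<in> obj h (I \<union> J)"
    using assms by (auto intro: prod_closed)
  then show "finite (I \<union> J)" "m I J a b \<in> obj h (I \<union> J)" .
  show "{(I' \<union> J', m I' J' a' b') |I' a' J' b'. (I', a') \<in> class_of h I a \<and>
      (J', b') \<in> class_of h J b \<and> I' \<inter> J' = {}} \<subseteq> class_of h (I \<union> J) (m I J a b)"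
  proof clarify
    fix I' a' J' b'
    assume "(I', a') \<in> class_of h I a" "(J', b') \<in> class_of h J b" and disj': "I' \<inter> J' = {}"
    then have I': "finite I'" "a' \<in> obj h I'" and J': "finite J'" "b' \<in> obj h J'"
      and "class_of h I' a' = class_of h I a" "class_of h J' b' = class_of h J b"
      by (auto simp: mem_class_of_iff I J)
    then obtain \<phi> \<psi> where \<phi>: "bij_betw \<phi> I' I" "act h I' I \<phi> a = a'"
      and \<psi>: "bij_betw \<psi> J' J" "act h J' J \<psi> b = b'"
      using class_of_eq_iff[OF I' I] class_of_eq_iff[OF J' J] by blast
    define \<chi> where "\<chi> = (\<lambda>x. if x \<in> I' then \<phi> x else \<psi> x)"
    have \<chi>: "bij_betw \<chi> (I' \<union> J') (I \<union> J)"
      unfolding \<chi>_def using \<phi>(1) \<psi>(1) disj' disj by (rule bij_betw_disjoint_Un)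
    have on_I: "\<phi> i = \<chi> i" if "i \<in> I'" for i
      using that by (simp add: \<chi>_def)
    have on_J: "\<psi> i = \<chi> i" if "i \<in> J'" for i
      using that disj' by (auto simp: \<chi>_def)
    have "\<chi> \<in> I' \<rightarrow> I" "\<chi> \<in> J' \<rightarrow> J"
      using \<phi>(1) \<psi>(1) on_I on_J by (auto simp: bij_betw_def)
    then have "act h (I' \<union> J') (I \<union> J) \<chi> (m I J a b) = m I' J' (act h I' I \<chi> a) (act h J' J \<chi> b)"
      using I J I' J' disj disj' \<chi> by (intro prod_natural) (auto simp: bij_betw_def)
    also have "act h I' I \<chi> a = a'"
      using act_cong[OF I'(1) I(1) bij_betw_in_injections[OF \<phi>(1)] on_I I(2)] \<phi>(2) by simp
    also have "act h J' J \<chi> b = b'"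
      using act_cong[OF J'(1) J(1) bij_betw_in_injections[OF \<psi>(1)] on_J J(2)] \<psi>(2) by simp
    finally have eq: "act h (I' \<union> J') (I \<union> J) \<chi> (m I J a b) = m I' J' a' b'" .
    have fin': "finite (I' \<union> J')" and ab': "m I' J' a' b' \<in> obj h (I' \<union> J')"
      using I' J' disj' by (auto intro: prod_closed)
    have "class_of h (I' \<union> J') (m I' J' a' b') = class_of h (I \<union> J) (m I J a b)"
      unfolding class_of_eq_iff[OF fin' ab' fin ab] using eq \<chi> by blast
    then show "(I' \<union> J', m I' J' a' b') \<in> class_of h (I \<union> J) (m I J a b)"
      unfolding mem_class_of_iff[OF fin ab] using fin' ab' by blast
  qed
  show "{(I' \<union> J', m I' J' a' b') |I' a' J' b'. (I', a') \<in> class_of h I a \<and>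
      (J', b') \<in> class_of h J b \<and> I' \<inter> J' = {}} \<noteq> {}"
    using self_mem_class_of[OF I] self_mem_class_of[OF J] disj by blast
qed

lemma disjoint_representative:
  assumes "B \<in> \<G> h" "finite N"
  obtains I a where "finite I" "a \<in> obj h I" "B = class_of h I a" "N \<inter> I = {}"
proof -
  obtain J b where J: "finite J" "b \<in> obj h J" "B = class_of h J b"
    using assms(1) by (rule iso_classesE)
  obtain k where k: "\<And>n. n \<in> N \<Longrightarrow> n < k"
    using assms(2) unfolding finite_nat_set_iff_bounded by blast
  \<comment> \<open>Shifting all labels by a strict upper bound of \<open>N\<close> moves the
    representative clear of \<open>N\<close>.\<close>
  let ?I = "(+) k ` J"
  have bij: "bij_betw (\<lambda>i. i - k) ?I J"
    by (rule bij_betw_byWitness[where f' = "(+) k"]) auto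
  have a: "act h ?I J (\<lambda>i. i - k) b \<in> obj h ?I"
    using J bij by (intro act_obj_bij) auto
  show ?thesis
  proof (rule that)
    show "B = class_of h ?I (act h ?I J (\<lambda>i. i - k) b)"
      using J bij a class_of_eq_iff[OF _ a J(1,2)] by auto
    show "N \<inter> ?I = {}"
      using k by fastforce
  qed (use J a in auto)
qed

lemma disjoint_representatives:
  assumes "B \<in> \<G> h" "C \<in> \<G> h"
  obtains I a J b where "finite I" "a \<in> obj h I" "B = class_of h I a"
    "finite J" "b \<in> obj h J" "C = class_of h J b" "I \<inter> J = {}"
    "mul B C = class_of h (I \<union> J) (m I J a b)"
proof -
  obtain I a where I: "finite I" "a \<in> obj h I" "B = class_of h I a"
    using assms(1) by (rule iso_classesE)
  obtain J b where J: "finite J" "b \<in> obj h J" "C = class_of h J b" "I \<inter> J = {}"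
    using assms(2) I(1) by (rule disjoint_representative)
  show ?thesis
    using that[OF I J] class_mult_class_of[OF I(1,2) J(1,2,4)] I(3) J(3) by simp
qed

section \<open>The monoid of classes, graded by size\<close>

lemma class_unit_in [simp]: "unit \<in> \<G> h"
  using unit_closed by (simp add: class_unit_eq)

lemma class_size_unit [simp]: "class_size unit = 0"
  using unit_closed by (simp add: class_unit_eq)

lemma class_mult_in [simp]: "\<lbrakk>B \<in> \<G> h; C \<in> \<G> h\<rbrakk> \<Longrightarrow> mul B C \<in> \<G> h"
  by (erule (1) disjoint_representatives) (simp add: prod_closed)

lemma class_size_mult [simp]:
  "\<lbrakk>B \<in> \<G> h; C \<in> \<G> h\<rbrakk> \<Longrightarrow> class_size (mul B C) = class_size B + class_size C"
  by (erule (1) disjoint_representatives) (simp add: prod_closed card_Un_disjoint)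

lemma class_mult_unit_left [simp]: "B \<in> \<G> h \<Longrightarrow> mul unit B = B"
  using class_mult_class_of[of "{}" e] unit_closed unit_left
  by (auto simp: class_unit_eq elim!: iso_classesE)

lemma class_mult_unit_right [simp]: "B \<in> \<G> h \<Longrightarrow> mul B unit = B"
  using class_mult_class_of[of _ _ "{}" e] unit_closed unit_right
  by (auto simp: class_unit_eq elim!: iso_classesE)

lemma class_mult_assoc:
  assumes "A \<in> \<G> h" "B \<in> \<G> h" "C \<in> \<G> h"
  shows "mul (mul A B) C = mul A (mul B C)"
proof -
  obtain I a J b where I: "finite I" "a \<in> obj h I" "A = class_of h I a"
    and J: "finite J" "b \<in> obj h J" "B = class_of h J b" "I \<inter> J = {}"
    using assms(1,2) by (rule disjoint_representatives)
  have "finite (I \<union> J)"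
    using I J by simp
  with assms(3) obtain K c where K: "finite K" "c \<in> obj h K" "C = class_of h K c" "(I \<union> J) \<inter> K = {}"
    by (rule disjoint_representative)
  then have disj: "I \<inter> K = {}" "J \<inter> K = {}" "I \<inter> (J \<union> K) = {}"
    using J by auto
  have "mul (mul A B) C = class_of h (I \<union> J \<union> K) (m (I \<union> J) K (m I J a b) c)"
    using I J K by (simp add: class_mult_class_of prod_closed)
  also have "\<dots> = mul A (mul B C)"
    using I J K disj by (simp add: class_mult_class_of prod_closed prod_assoc Un_assoc)
  finally show ?thesis .
qed

section \<open>Coproduct and counit\<close>

lemma pattern_at_mult:
  assumes "finite I" "a \<in> obj h I" "finite J" "b \<in> obj h J" "I \<inter> J = {}" "K \<subseteq> I" "L \<subseteq> J"
  shows "pattern_at h (I \<union> J) (m I J a b) (K \<union> L) = mul (pattern_at h I a K) (pattern_at h J b L)"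
proof -
  have *: "finite K" "finite L" "K \<inter> L = {}"
    using assms by (auto intro: finite_subset)
  have "restr h (I \<union> J) (K \<union> L) (m I J a b) = m K L (restr h I K a) (restr h J L b)"
    unfolding restr_def using assms * by (intro prod_natural) auto
  then show ?thesis
    using assms * by (simp add: pattern_at_def class_mult_class_of restr_closed)
qed

lemma finite_decompositions: "finite {(b, c). b \<in> \<G> h \<and> c \<in> \<G> h \<and> mul b c = a}"
  by (rule finite_subset[of _ "{b \<in> \<G> h. class_size b \<le> class_size a} \<times> {b \<in> \<G> h. class_size b \<le> class_size a}"])
    (auto simp: finite_iso_classes_le)

text \<open>A subset of the disjoint union is a pair of subsets, and its pattern is the product of
  the two patterns. Sorting the pairs by their two patterns gives the factorizations of
  \<open>a\<close>; this is why the coproduct is a pullback along \<open>mul\<close>.\<close>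

lemma pattern_fun_class_mult:
  assumes a: "a \<in> \<G> h" and "B \<in> \<G> h" "C \<in> \<G> h"
  shows "pattern_fun h a (mul B C)
    = (\<Sum>(b, c)\<in>{(b, c). b \<in> \<G> h \<and> c \<in> \<G> h \<and> mul b c = a}. pattern_fun h b B * pattern_fun h c C)"
proof -
  let ?D = "{(b, c). b \<in> \<G> h \<and> c \<in> \<G> h \<and> mul b c = a}"
  obtain I x J y where I: "finite I" "x \<in> obj h I" and B: "B = class_of h I x"
    and J: "finite J" "y \<in> obj h J" and C: "C = class_of h J y" and disj: "I \<inter> J = {}"
    and BC: "mul B C = class_of h (I \<union> J) (m I J x y)"
    using assms(2,3) by (rule disjoint_representatives)
  let ?P = "\<lambda>(K, L). (pattern_at h I x K, pattern_at h J y L)"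
  have "(\<Sum>(b, c)\<in>?D. pattern_fun h b B * pattern_fun h c C)
      = (\<Sum>q\<in>?D. \<Sum>p\<in>Pow I \<times> Pow J. if ?P p = q then 1 else 0)"
  proof (rule sum.cong)
    fix q assume "q \<in> ?D"
    then obtain b c where q: "q = (b, c)" "b \<in> \<G> h" "c \<in> \<G> h"
      by auto
    then have "pattern_fun h b B * pattern_fun h c C = (\<Sum>K\<in>Pow I. \<Sum>L\<in>Pow J.
        (if pattern_at h I x K = b then 1 else 0) * (if pattern_at h J y L = c then 1 else 0))"
      by (simp add: B C I J pattern_fun_sum sum_product)
    also have "\<dots> = (\<Sum>p\<in>Pow I \<times> Pow J. if ?P p = q then 1 else 0)"
      unfolding sum.cartesian_product by (rule sum.cong[OF refl], elim SigmaE) (simp add: q)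
    finally show "(case q of (b, c) \<Rightarrow> pattern_fun h b B * pattern_fun h c C)
        = (\<Sum>p\<in>Pow I \<times> Pow J. if ?P p = q then 1 else 0)"
      by (simp add: q)
  qed simp
  also have "\<dots> = (\<Sum>p\<in>Pow I \<times> Pow J. \<Sum>q\<in>?D. if ?P p = q then 1 else 0)"
    by (rule sum.swap)
  also have "\<dots> = (\<Sum>p\<in>Pow I \<times> Pow J. if ?P p \<in> ?D then 1 else 0)"
    by (simp add: sum.delta'[OF finite_decompositions])
  also have "\<dots> = (\<Sum>K\<in>Pow (I \<union> J). if pattern_at h (I \<union> J) (m I J x y) K = a then 1 else 0)"
  proof (rule sum.reindex_bij_witness[of _ "\<lambda>K. (K \<inter> I, K \<inter> J)" "\<lambda>(K, L). K \<union> L"])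
    fix p assume "p \<in> Pow I \<times> Pow J"
    then obtain K L where p: "p = (K, L)" "K \<subseteq> I" "L \<subseteq> J"
      by auto
    then show "((case p of (K, L) \<Rightarrow> K \<union> L) \<inter> I, (case p of (K, L) \<Rightarrow> K \<union> L) \<inter> J) = p"
      "(case p of (K, L) \<Rightarrow> K \<union> L) \<in> Pow (I \<union> J)"
      using disj by auto
    show "(if pattern_at h (I \<union> J) (m I J x y) (case p of (K, L) \<Rightarrow> K \<union> L) = a then 1 else 0)
        = (if ?P p \<in> ?D then 1 else 0)"
      using p I J disj by (simp add: pattern_at_mult)
  qed auto
  also have "\<dots> = pattern_fun h a (mul B C)"
    using a I J disj by (simp add: BC pattern_fun_sum prod_closed)
  finally show ?thesis ..
qed

lemma pattern_fun_unit: "a \<in> \<G> h \<Longrightarrow> pattern_fun h a unit = (if a = unit then 1 else 0)"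
  using unit_closed by (auto simp: class_unit_eq pattern_fun_sum)

abbreviation "comul \<equiv> pullback (\<G> h \<times> \<G> h) (\<lambda>(b, c). mul b c)"

lemma comul_pattern_fun:
  assumes "a \<in> \<G> h"
  shows "comul (pattern_fun h a) = (\<Sum>(b, c) \<in> {(b, c). b \<in> \<G> h \<and> c \<in> \<G> h \<and> mul b c = a}.
    pattern_fun h b \<otimes> pattern_fun h c)"
  using pattern_fun_class_mult[OF assms]
  by (auto simp: fun_eq_iff pullback_def sum_fun_apply tensor_def case_prod_unfold pattern_fun_outside)

lemma comul_in:
  assumes "F \<in> \<A> h"
  shows "comul F \<in> tensor_space (\<A> h) (\<A> h)"
proof (rule linear_on_span_into[OF linear_on_pullback subspace_tensor_space])
  show "F \<in> fs.span (pattern_fun h ` \<G> h)"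
    using assms by (simp add: pattern_space_def)
  show "comul G \<in> tensor_space (\<A> h) (\<A> h)" if "G \<in> pattern_fun h ` \<G> h" for G
    using that by (auto simp only: comul_pattern_fun
        intro!: fs.subspace_sum subspace_tensor_space tensor_in_tensor_space pattern_fun_in)
qed

lemma pattern_comult_eq: "pattern_comult h m = restrict comul (\<A> h)"
  unfolding pattern_comult_def
  by (rule linear_extension_eq[OF pattern_space_def linear_on_pullback comul_in comul_pattern_fun])

lemma pattern_counit_eq: "pattern_counit h e = restrict (\<lambda>F. F unit) (\<A> h)"
  unfolding pattern_counit_def
  by (rule linear_extension_eq[OF pattern_space_def linear_on_eval UNIV_I pattern_fun_unit])

end

lemma pattern_bialgebra_simps [simp]:
  "carr (pattern_bialgebra h m e) = \<A> h"
  "unt (pattern_bialgebra h m e) = (\<lambda>B. if B \<in> \<G> h then 1 else 0)"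
  "comult (pattern_bialgebra h m e) = pattern_comult h m"
  "counit (pattern_bialgebra h m e) = pattern_counit h e"
  by (simp_all add: pattern_bialgebra_def pattern_algebra_def fun_algebra.defs fun_bialgebra.defs)

section \<open>Compatibility with coproduct and counit\<close>

locale associative_presheaf_morphism =
  h: associative_presheaf h mh eh + j: associative_presheaf j mj ej +
  combinatorial_presheaf_morphism h j f
  for h :: "'a presheaf" and mh eh and j :: "'b presheaf" and mj ej and f +
  assumes mor_unit: "f {} eh = ej"
    and mor_prod: "\<lbrakk>finite I; finite J; I \<inter> J = {}; b \<in> obj h I; c \<in> obj h J\<rbrakk> \<Longrightarrow>
      f (I \<union> J) (mh I J b c) = mj I J (f I b) (f J c)"
begin

lemma class_map_unit [simp]: "class_map j f h.unit = j.unit"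
  by (simp add: h.class_unit_eq j.class_unit_eq class_map_class_of h.unit_closed mor_unit)

lemma class_map_mult [simp]:
  assumes "B \<in> \<G> h" "C \<in> \<G> h"
  shows "class_map j f (h.mul B C) = j.mul (class_map j f B) (class_map j f C)"
proof -
  obtain I a J b where *: "finite I" "a \<in> obj h I" "B = class_of h I a"
    "finite J" "b \<in> obj h J" "C = class_of h J b" "I \<inter> J = {}"
    "h.mul B C = class_of h (I \<union> J) (mh I J a b)"
    using assms by (rule h.disjoint_representatives)
  then show ?thesis
    using j.class_mult_class_of[of I "f I a" J "f J b"]
    by (simp add: class_map_class_of h.prod_closed mor_closed mor_prod)
qed

lemma bialgebra_morphism_pattern_map:
  "bialgebra_morphism (pattern_bialgebra j mj ej) (pattern_bialgebra h mh eh) (pattern_map h j f)"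
  unfolding bialgebra_morphism_def coalgebra_morphism_def
proof (intro conjI ballI)
  show "algebra_morphism (pattern_bialgebra j mj ej) (pattern_bialgebra h mh eh) (pattern_map h j f)"
    using algebra_morphism_pattern_map by (simp add: algebra_morphism_def pattern_algebra_def)
  let ?L = "pattern_map h j f"
  \<comment> \<open>The closed formula for the tensor square of the map: pullback along the class
    map in both variables.\<close>
  let ?M = "pullback (\<G> h \<times> \<G> h) (map_prod (class_map j f) (class_map j f))"
  have M: "tensor_map (\<A> j) (\<A> j) (\<A> h) (\<A> h) ?L ?L = restrict ?M (tensor_space (\<A> j) (\<A> j))"
  proof (rule tensor_map_eq[OF linear_on_pullback])
    show "?M (F \<otimes> G) = ?L F \<otimes> ?L G" if "F \<in> \<A> j" "G \<in> \<A> j" for F G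
      using that by (auto simp: pattern_map_eq pullback_def tensor_def fun_eq_iff)
  qed (auto simp: pattern_map_eq pull_in)
  fix F assume "F \<in> carr (pattern_bialgebra j mj ej)"
  then have F: "F \<in> \<A> j"
    by simp
  then have L: "?L F = pull F"
    by (simp add: pattern_map_eq)
  \<comment> \<open>At a pair of classes both sides evaluate \<open>F\<close> at the image of their
    product, by \<open>class_map_mult\<close>.\<close>
  have "h.comul (pull F) = ?M (j.comul F)"
    by (auto simp: pullback_def fun_eq_iff)
  then show "comult (pattern_bialgebra h mh eh) (?L F)
      = tensor_map (carr (pattern_bialgebra j mj ej)) (carr (pattern_bialgebra j mj ej))
          (carr (pattern_bialgebra h mh eh)) (carr (pattern_bialgebra h mh eh)) ?L ?L
          (comult (pattern_bialgebra j mj ej) F)"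
    using F by (simp add: M h.pattern_comult_eq j.pattern_comult_eq j.comul_in L pull_in)
  show "counit (pattern_bialgebra h mh eh) (?L F) = counit (pattern_bialgebra j mj ej) F"
    using F by (simp add: h.pattern_counit_eq j.pattern_counit_eq L pull_in)
      (simp add: pullback_def)
qed (simp add: pattern_map_linear)

end

section \<open>Inversion in graded connected monoids\<close>

text \<open>Abstracted from classes so that the same results also apply to the opposite
  monoid.\<close>

locale graded_monoid =
  fixes G :: "'x set" and mul :: "'x \<Rightarrow> 'x \<Rightarrow> 'x" and u :: 'x and sz :: "'x \<Rightarrow> nat"
  assumes mul_in [simp]: "\<lbrakk>a \<in> G; b \<in> G\<rbrakk> \<Longrightarrow> mul a b \<in> G"
    and u_in [simp]: "u \<in> G"
    and mul_assoc: "\<lbrakk>a \<in> G; b \<in> G; c \<in> G\<rbrakk> \<Longrightarrow> mul (mul a b) c = mul a (mul b c)"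
    and mul_u_left [simp]: "a \<in> G \<Longrightarrow> mul u a = a"
    and mul_u_right [simp]: "a \<in> G \<Longrightarrow> mul a u = a"
    and sz_mul [simp]: "\<lbrakk>a \<in> G; b \<in> G\<rbrakk> \<Longrightarrow> sz (mul a b) = sz a + sz b"
    and sz_eq_0: "\<lbrakk>a \<in> G; sz a = 0\<rbrakk> \<Longrightarrow> a = u"
    and finite_sz_le: "finite {a \<in> G. sz a \<le> n}"
begin

lemma sz_u [simp]: "sz u = 0"
  using sz_mul[of u u] by simp

definition words :: "'x \<Rightarrow> 'x list set" where
  "words a = {xs. set xs \<subseteq> G - {u} \<and> foldr mul xs u = a}"

text \<open>The geometric series of convolution powers of \<open>q\<close>, with the value at
  \<open>u\<close> replaced by 0. For \<open>q\<close> the negative of a function with value 1 at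
  \<open>u\<close>, this is the convolution inverse of that function.\<close>

definition inversion :: "('x \<Rightarrow> rat) \<Rightarrow> 'x \<Rightarrow> rat" where
  "inversion q a = (\<Sum>xs\<in>words a. prod_list (map q xs))"

abbreviation decompositions :: "'x \<Rightarrow> ('x \<times> 'x) set" where
  "decompositions a \<equiv> {(b, c). b \<in> G \<and> c \<in> G \<and> mul b c = a}"

lemma foldr_mul_in [simp]: "set xs \<subseteq> G \<Longrightarrow> foldr mul xs u \<in> G"
  by (induction xs) auto

lemma foldr_mul_nonunits_in [simp]: "set xs \<subseteq> G - {u} \<Longrightarrow> foldr mul xs u \<in> G"
  by (rule foldr_mul_in) auto

text \<open>Non-units have positive size, so the size of \<open>a\<close> bounds both the length of
  a word and the size of its letters.\<close>

lemma finite_words: "finite (words a)"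
proof (rule finite_subset)
  have "set xs \<subseteq> {b \<in> G. sz b \<le> sz (foldr mul xs u)} \<and> length xs \<le> sz (foldr mul xs u)"
    if "set xs \<subseteq> G - {u}" for xs
    using that
  proof (induction xs)
    case (Cons x xs)
    then have "sz x \<noteq> 0" "set xs \<subseteq> G"
      using sz_eq_0 by auto
    with Cons show ?case
      by auto
  qed simp
  then show "words a \<subseteq> {xs. set xs \<subseteq> {b \<in> G. sz b \<le> sz a} \<and> length xs \<le> sz a}"
    by (auto simp: words_def)
  show "finite {xs. set xs \<subseteq> {b \<in> G. sz b \<le> sz a} \<and> length xs \<le> sz a}"
    by (rule finite_lists_length_le[OF finite_sz_le])
qed

lemma finite_decompositions: "finite (decompositions a)"
  by (rule finite_subset[of _ "{b \<in> G. sz b \<le> sz a} \<times> {b \<in> G. sz b \<le> sz a}"])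
    (auto simp: finite_sz_le)

text \<open>Splits off the first letter of a word; the empty word, which factors only
  \<open>u\<close>, gives the initial term.\<close>

lemma inversion_rec:
  "inversion q a = (if a = u then 1 else 0)
    + (\<Sum>(b, c)\<in>{(b, c) \<in> decompositions a. b \<noteq> u}. q b * inversion q c)"
proof -
  let ?D = "{(b, c) \<in> decompositions a. b \<noteq> u}"
  have fin: "finite ?D"
    by (rule finite_subset[OF _ finite_decompositions[of a]]) auto
  have "inversion q a = (\<Sum>xs\<in>words a \<inter> {[]}. prod_list (map q xs))
      + (\<Sum>xs\<in>words a - {[]}. prod_list (map q xs))"
    unfolding inversion_def by (rule sum.Int_Diff[OF finite_words])
  also have "(\<Sum>xs\<in>words a \<inter> {[]}. prod_list (map q xs)) = (if a = u then 1 else 0)"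
  proof -
    have "words a \<inter> {[]} = (if a = u then {[]} else {})"
      by (auto simp: words_def)
    then show ?thesis
      by simp
  qed
  also have "(\<Sum>xs\<in>words a - {[]}. prod_list (map q xs))
      = (\<Sum>(p, ys)\<in>Sigma ?D (\<lambda>p. words (snd p)). q (fst p) * prod_list (map q ys))"
    by (rule sum.reindex_bij_witness[of _ "\<lambda>(p, ys). fst p # ys"
          "\<lambda>xs. ((hd xs, foldr mul (tl xs) u), tl xs)"])
      (auto simp: words_def neq_Nil_conv)
  also have "\<dots> = (\<Sum>p\<in>?D. \<Sum>ys\<in>words (snd p). q (fst p) * prod_list (map q ys))"
    by (rule sum.Sigma[OF fin, symmetric]) (simp add: finite_words)
  also have "\<dots> = (\<Sum>(b, c)\<in>?D. q b * inversion q c)"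
    by (simp add: inversion_def sum_distrib_left case_prod_unfold)
  finally show ?thesis .
qed

text \<open>The factorization with first factor \<open>u\<close> contributes the inversion of
  \<open>a\<close> itself, and by \<open>inversion_rec\<close> the remaining terms cancel all but
  its initial term.\<close>

lemma inversion_left:
  assumes a: "a \<in> G" and p: "p u = 1"
  shows "(\<Sum>(b, c)\<in>decompositions a. p b * inversion (\<lambda>b. - p b) c) = (if a = u then 1 else 0)"
proof -
  let ?D = "{(b, c) \<in> decompositions a. b \<noteq> u}"
  have D: "decompositions a = insert (u, a) ?D"
    using a by auto
  have fin: "finite ?D"
    by (rule finite_subset[OF _ finite_decompositions[of a]]) auto
  have "(\<Sum>(b, c)\<in>decompositions a. p b * inversion (\<lambda>b. - p b) c)
      = inversion (\<lambda>b. - p b) a + (\<Sum>(b, c)\<in>?D. p b * inversion (\<lambda>b. - p b) c)"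
    by (subst D, subst sum.insert[OF fin]) (auto simp: p)
  also have "\<dots> = (if a = u then 1 else 0)"
    by (subst inversion_rec) (simp add: case_prod_unfold sum_negf)
  finally show ?thesis .
qed

text \<open>Reversing words passes to the opposite monoid and leaves the inversion unchanged.\<close>

lemma inversion_right:
  assumes a: "a \<in> G" and p: "p u = 1"
  shows "(\<Sum>(b, c)\<in>decompositions a. inversion (\<lambda>b. - p b) b * p c) = (if a = u then 1 else 0)"
proof -
  interpret op: graded_monoid G "\<lambda>x y. mul y x" u sz
    by unfold_locales (auto simp: mul_assoc sz_eq_0 finite_sz_le)
  have foldl_mul: "foldl mul b xs = mul b (foldr mul xs u)" if "b \<in> G" "set xs \<subseteq> G" for b xs
    using that by (induction xs arbitrary: b) (auto simp: mul_assoc)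
  \<comment> \<open>A right fold over the reversed word is a left fold over the word, which
    associativity turns back into a right fold.\<close>
  have rev: "foldr (\<lambda>x y. mul y x) (rev xs) u = foldr mul xs u" if "set xs \<subseteq> G - {u}" for xs
    using that foldl_mul[of u xs] by (auto simp: foldr_conv_foldl[of _ "rev xs"])
  have words: "rev xs \<in> op.words c \<longleftrightarrow> xs \<in> words c" for xs c
    by (simp add: words_def op.words_def rev cong: conj_cong)
  have inv: "op.inversion q c = inversion q c" for q c
    unfolding inversion_def op.inversion_def
    by (rule sum.reindex_bij_witness[of _ rev rev])
      (use words in \<open>auto simp: rev_map[symmetric] prod_list.rev intro: iffD1[OF words]\<close>)
  have "(\<Sum>(b, c)\<in>decompositions a. inversion (\<lambda>b. - p b) b * p c)
      = (\<Sum>(b, c)\<in>op.decompositions a. p b * op.inversion (\<lambda>b. - p b) c)"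
    by (rule sum.reindex_bij_witness[of _ "\<lambda>(b, c). (c, b)" "\<lambda>(b, c). (c, b)"]) (auto simp: inv)
  then show ?thesis
    using op.inversion_left[of a p] a p by simp
qed

end

section \<open>Inversion and size-preserving homomorphisms\<close>

locale graded_monoid_hom =
  A: graded_monoid G mul u sz + B: graded_monoid G' mul' u' sz'
  for G :: "'x set" and mul u sz and G' :: "'y set" and mul' u' sz' +
  fixes g :: "'x \<Rightarrow> 'y"
  assumes g_in: "b \<in> G \<Longrightarrow> g b \<in> G'"
    and g_u: "g u = u'"
    and g_mul: "\<lbrakk>b \<in> G; c \<in> G\<rbrakk> \<Longrightarrow> g (mul b c) = mul' (g b) (g c)"
    and g_sz: "b \<in> G \<Longrightarrow> sz' (g b) = sz b"
begin

text \<open>Size is preserved and only units have size 0. Hence words of non-units map to words of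
  non-units.\<close>

lemma g_eq_u_iff: "b \<in> G \<Longrightarrow> g b = u' \<longleftrightarrow> b = u"
  by (metis g_u g_sz A.sz_eq_0 B.sz_u)

lemma g_foldr: "set ys \<subseteq> G \<Longrightarrow> foldr mul' (map g ys) u' = g (foldr mul ys u)"
  by (induction ys) (auto simp: g_u g_mul)

lemma finite_fibre: "finite {b \<in> G. g b = a}"
  by (rule finite_subset[OF _ A.finite_sz_le[of "sz' a"]]) (auto simp: g_sz)

text \<open>Expanding a product of sums over fibres amounts to choosing a preimage of every letter;
  preimages of non-units are non-units because \<open>g u = u'\<close>.\<close>

lemma prod_list_lifts:
  fixes q :: "'x \<Rightarrow> rat"
  assumes q: "\<And>b. b \<in> G' \<Longrightarrow> q' b = (\<Sum>c\<in>{c \<in> G. g c = b}. q c)" and "set xs \<subseteq> G' - {u'}"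
  shows "prod_list (map q' xs)
    = (\<Sum>ys\<in>{ys. set ys \<subseteq> G - {u} \<and> map g ys = xs}. prod_list (map q ys))"
  using assms(2)
proof (induction xs)
  case Nil
  have "{ys. set ys \<subseteq> G - {u} \<and> map g ys = []} = {[]}"
    by auto
  then show ?case
    by simp
next
  case (Cons x xs)
  let ?lifts = "\<lambda>xs. {ys. set ys \<subseteq> G - {u} \<and> map g ys = xs}"
  have "prod_list (map q' (x # xs))
      = (\<Sum>c\<in>{c \<in> G. g c = x}. q c) * (\<Sum>ys\<in>?lifts xs. prod_list (map q ys))"
    using Cons by (simp add: q)
  also have "\<dots> = (\<Sum>(c, ys)\<in>{c \<in> G. g c = x} \<times> ?lifts xs. q c * prod_list (map q ys))"
    by (simp only: sum_product sum.cartesian_product)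
  also have "\<dots> = (\<Sum>ys\<in>?lifts (x # xs). prod_list (map q ys))"
    using Cons.prems g_u
    by (intro sum.reindex_bij_witness[of _ "\<lambda>ys. (hd ys, tl ys)" "\<lambda>(c, ys). c # ys"]) auto
  finally show ?case .
qed

text \<open>The set \<open>?Y\<close> of words in \<open>G\<close> whose product lies over
  \<open>a\<close> is grouped in two ways: by the letterwise image, giving the left side through
  \<open>prod_list_lifts\<close>, and by the product in \<open>G\<close>, giving the right
  side.\<close>

lemma inversion_hom:
  assumes q: "\<And>b. b \<in> G' \<Longrightarrow> q' b = (\<Sum>c\<in>{c \<in> G. g c = b}. q c)"
  shows "B.inversion q' a = (\<Sum>b\<in>{b \<in> G. g b = a}. A.inversion q b)"
proof -
  let ?Y = "{ys. set ys \<subseteq> G - {u} \<and> g (foldr mul ys u) = a}"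
  let ?P = "\<lambda>ys. prod_list (map q ys)"
  have "?Y = (\<Union>b\<in>{b \<in> G. g b = a}. A.words b)"
    by (auto simp: A.words_def)
  then have fin: "finite ?Y"
    using finite_fibre A.finite_words by simp
  have "B.inversion q' a = (\<Sum>xs\<in>B.words a. sum ?P {ys \<in> ?Y. map g ys = xs})"
    unfolding B.inversion_def
  proof (rule sum.cong)
    fix xs assume xs: "xs \<in> B.words a"
    then have "{ys \<in> ?Y. map g ys = xs} = {ys. set ys \<subseteq> G - {u} \<and> map g ys = xs}"
      by (auto simp: B.words_def g_foldr[symmetric] Diff_subset[THEN subset_trans[rotated]])
    with xs show "prod_list (map q' xs) = sum ?P {ys \<in> ?Y. map g ys = xs}"
      by (simp add: B.words_def prod_list_lifts[OF q])
  qed simp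
  also have "\<dots> = sum ?P ?Y"
  proof (rule sum.group[OF fin B.finite_words])
    show "map g ` ?Y \<subseteq> B.words a"
      using g_eq_u_iff g_in g_foldr by (fastforce simp: B.words_def)
  qed
  also have "\<dots> = (\<Sum>b\<in>{b \<in> G. g b = a}. sum ?P {ys \<in> ?Y. foldr mul ys u = b})"
    by (rule sum.group[OF fin finite_fibre, symmetric]) auto
  also have "\<dots> = (\<Sum>b\<in>{b \<in> G. g b = a}. A.inversion q b)"
    unfolding A.inversion_def A.words_def by (intro sum.cong) auto
  finally show ?thesis .
qed

end

section \<open>The antipode\<close>

locale connected_associative_presheaf = associative_presheaf +
  assumes connected: "connected_presheaf h"
begin

text \<open>Connectedness enters here: \<open>e\<close> is the only object on the empty label
  set.\<close>

lemma class_size_eq_0: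
  assumes "B \<in> \<G> h" "class_size B = 0"
  shows "B = unit"
proof -
  obtain I a where I: "finite I" "a \<in> obj h I" "B = class_of h I a"
    using assms(1) by (rule iso_classesE)
  then have "I = {}"
    using assms(2) by simp
  moreover have "obj h {} = {e}"
    using connected unit_closed by (auto simp: connected_presheaf_def card_1_singleton_iff)
  ultimately show ?thesis
    using I by (simp add: class_unit_eq)
qed

sublocale classes: graded_monoid "\<G> h" mul unit class_size
  by unfold_locales (simp_all add: class_mult_assoc class_size_eq_0 finite_iso_classes_le)

text \<open>The empty subset is the one occurrence of the unit. For fixed \<open>B\<close> this is
  the normalization \<open>p u = 1\<close> of the inversion lemmas.\<close>

lemma pattern_fun_unit_eq_1:
  assumes "B \<in> \<G> h"
  shows "pattern_fun h unit B = 1"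
proof -
  obtain I x where I: "finite I" "x \<in> obj h I" "B = class_of h I x"
    using assms by (rule iso_classesE)
  have "J = {}" if J: "J \<subseteq> I" "pattern_at h I x J = unit" for J
  proof -
    have "card J = class_size unit"
      using class_size_pattern_at[OF I(1,2) J(1)] J(2) by simp
    then show ?thesis
      using finite_subset[OF J(1) I(1)] by simp
  qed
  moreover have "pattern_at h I x {} = unit"
    using I by (intro class_size_eq_0) auto
  ultimately have "{J. J \<subseteq> I \<and> pattern_at h I x J = unit} = {{}}"
    by auto
  then show ?thesis
    using pattern_fun_card[OF class_unit_in I(1,2)] I(3) by simp
qed

text \<open>Takeuchi's formula for the antipode at the pattern function of \<open>a\<close>,
  evaluated at \<open>B\<close>: the function sending a class \<open>b\<close> to
  \<open>pattern_fun h b B\<close> is inverted under convolution for each \<open>B\<close>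
  separately.\<close>

definition antipode_fun :: "'a iso_class \<Rightarrow> 'a iso_class \<Rightarrow> rat" where
  "antipode_fun a = (\<lambda>B. if B \<in> \<G> h then classes.inversion (\<lambda>b. - pattern_fun h b B) a else 0)"

text \<open>Each word contributes, up to sign, a product of pattern functions, so closure under
  multiplication applies; the empty word contributes the unit.\<close>

lemma antipode_fun_in: "antipode_fun a \<in> \<A> h"
proof -
  define W where
    "W = (\<lambda>xs B. if B \<in> \<G> h then prod_list (map (\<lambda>b. - pattern_fun h b B) xs) else (0::rat))"
  have W: "W xs \<in> \<A> h" if "set xs \<subseteq> \<G> h" for xs
    using that
  proof (induction xs)
    case Nil
    have "W [] = (\<lambda>B. if B \<in> \<G> h then 1 else 0)"
      by (auto simp: W_def fun_eq_iff)
    then show ?case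
      by (simp only: unit_in_pattern_space)
  next
    case (Cons b xs)
    have "W (b # xs) = fscale (- 1) (pattern_fun h b * W xs)"
      by (auto simp: W_def fscale_def fun_eq_iff)
    with Cons show ?case
      by (simp only: list.set insert_subset fs.subspace_scale[OF subspace_pattern_space]
          pattern_space_mult pattern_fun_in)
  qed
  have "antipode_fun a = (\<Sum>xs\<in>classes.words a. W xs)"
    by (auto simp: antipode_fun_def W_def classes.inversion_def fun_eq_iff sum_fun_apply)
  also have "\<dots> \<in> \<A> h"
    by (intro fs.subspace_sum subspace_pattern_space W) (auto simp: classes.words_def)
  finally show ?thesis .
qed

text \<open>Pointwise multiplication is evaluation of a two-variable function on the
  diagonal.\<close>

lemma mult_map_eq:
  "mult_map (pattern_bialgebra h m e) = restrict (\<lambda>T x. T (x, x)) (tensor_space (\<A> h) (\<A> h))"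
  (is "_ = restrict ?diag ?T")
proof -
  have lin: "linear_on fscale V ?diag" for V
    by (auto simp: linear_on_def fscale_def)
  have diag: "?diag (F \<otimes> G) = F * G" for F G :: "'a iso_class \<Rightarrow> rat"
    by (auto simp: tensor_def fun_eq_iff)
  have "?diag x \<in> \<A> h" if "x \<in> ?T" for x
  proof (rule linear_on_span_into[OF lin subspace_pattern_space])
    show "x \<in> fs.span ((\<lambda>(F, G). F \<otimes> G) ` (\<A> h \<times> \<A> h))"
      using that by (simp only: tensor_space_eq)
    show "?diag y \<in> \<A> h" if "y \<in> (\<lambda>(F, G). F \<otimes> G) ` (\<A> h \<times> \<A> h)" for y
      using that by (elim imageE SigmaE) (simp only: prod.case diag pattern_space_mult)
  qed
  then show ?thesis
    unfolding mult_map_def pattern_bialgebra_simps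
    by (intro linear_extension_eq[OF tensor_space_eq lin]) (auto simp only: diag prod.case)
qed

text \<open>Reduces an antipode identity in the algebra to a numerical one for each generator
  \<open>a\<close> and each point \<open>B\<close>. Taking the identity as \<open>K\<close> or as
  \<open>L\<close> yields the two antipode axioms.\<close>

lemma convolution_eqI:
  assumes K: "linear_on fscale (\<A> h) K" "\<And>F. F \<in> \<A> h \<Longrightarrow> K F \<in> \<A> h"
    and L: "linear_on fscale (\<A> h) L" "\<And>F. F \<in> \<A> h \<Longrightarrow> L F \<in> \<A> h"
    and conv: "\<And>a B. a \<in> \<G> h \<Longrightarrow> B \<in> \<G> h \<Longrightarrow>
      (\<Sum>(b, c)\<in>classes.decompositions a. K (pattern_fun h b) B * L (pattern_fun h c) B)
        = (if a = unit then 1 else 0)"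
    and F: "F \<in> \<A> h"
  shows "mult_map (pattern_bialgebra h m e) (tensor_map (\<A> h) (\<A> h) (\<A> h) (\<A> h) K L
      (pattern_comult h m F)) = fscale (pattern_counit h e F) (\<lambda>B. if B \<in> \<G> h then 1 else 0)"
proof -
  let ?T = "tensor_space (\<A> h) (\<A> h)"
  let ?one = "\<lambda>B. if B \<in> \<G> h then 1 else 0 :: rat"
  let ?M = "tensor_map (\<A> h) (\<A> h) (\<A> h) (\<A> h) K L"
  note M = tensor_map_linear[OF subspace_pattern_space subspace_pattern_space K L]
  define conv_map where "conv_map = (\<lambda>F x. ?M (comul F) (x, x))"
  have "linear_on fscale (\<A> h) (\<lambda>F. ?M (comul F))"
    by (rule linear_on_compose[OF linear_on_pullback M(1) comul_in])
  then have lin: "linear_on fscale (\<A> h) conv_map"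
    by (auto simp: linear_on_def conv_map_def fscale_def)
  have lin': "linear_on fscale (\<A> h) (\<lambda>F. fscale (F unit) ?one)"
    by (auto simp: linear_on_def fscale_def algebra_simps)
  have gen: "conv_map (pattern_fun h a) = fscale (pattern_fun h a unit) ?one" if a: "a \<in> \<G> h" for a
  proof -
    have "?M (comul (pattern_fun h a))
        = (\<Sum>(b, c)\<in>classes.decompositions a. K (pattern_fun h b) \<otimes> L (pattern_fun h c))"
      unfolding comul_pattern_fun[OF a]
      by (subst linear_on_sum[OF M(1) subspace_tensor_space])
        (auto simp only: prod.case mem_Collect_eq M(2) pattern_fun_in tensor_in_tensor_space intro!: sum.cong)
    then have eval: "conv_map (pattern_fun h a) B
        = (\<Sum>(b, c)\<in>classes.decompositions a. K (pattern_fun h b) B * L (pattern_fun h c) B)" for B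
      by (simp add: conv_map_def sum_fun_apply tensor_def case_prod_unfold)
    show ?thesis
    proof
      fix B
      show "conv_map (pattern_fun h a) B = fscale (pattern_fun h a unit) ?one B"
      proof (cases "B \<in> \<G> h")
        case True
        with a show ?thesis
          by (simp add: eval conv pattern_fun_unit fscale_def)
      next
        case False
        \<comment> \<open>Off the set of classes both sides vanish, since elements of the pattern
          space are 0 there.\<close>
        then have "K (pattern_fun h b) B = 0" if "b \<in> \<G> h" for b
          using that pattern_space_outside[OF K(2)] pattern_fun_in by blast
        then show ?thesis
          unfolding eval using False by (simp add: fscale_def) (auto intro: sum.neutral)
      qed
    qed
  qed
  have "conv_map F = fscale (F unit) ?one"
    using linear_on_span_eq[of fscale "pattern_fun h ` \<G> h" conv_map _ F] lin lin' gen F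
    unfolding pattern_space_def[symmetric] by blast
  then show ?thesis
    using F by (simp add: mult_map_eq pattern_comult_eq pattern_counit_eq M(3) comul_in conv_map_def)
qed

lemma antipode_exists:
  obtains S where "is_antipode (pattern_bialgebra h m e) S"
    and "\<And>a. a \<in> \<G> h \<Longrightarrow> S (pattern_fun h a) = antipode_fun a"
proof -
  interpret vs: vector_space_pair "fscale :: rat \<Rightarrow> ('a iso_class \<Rightarrow> rat) \<Rightarrow> _"
    "fscale :: rat \<Rightarrow> ('a iso_class \<Rightarrow> rat) \<Rightarrow> _" ..
  \<comment> \<open>The antipode is prescribed on generators, so linear independence provides the
    extension; injectivity lets \<open>inv_into\<close> recover a class from its pattern
    function.\<close>
  obtain T where T: "Vector_Spaces.linear fscale fscale T"
    and T_val: "\<And>p. p \<in> pattern_fun h ` \<G> h \<Longrightarrow> T p = antipode_fun (inv_into (\<G> h) (pattern_fun h) p)"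
    using vs.linear_independent_extend[OF pattern_fun_independent(2),
        of "\<lambda>p. antipode_fun (inv_into (\<G> h) (pattern_fun h) p)"] by blast
  interpret T: Vector_Spaces.linear fscale fscale T by (fact T)
  let ?A = "pattern_bialgebra h m e"
  let ?S = "restrict T (\<A> h)"
  have lin: "linear_on fscale V T" for V
    unfolding linear_on_def using T.add T.scale by blast
  have val: "T (pattern_fun h a) = antipode_fun a" if "a \<in> \<G> h" for a
    using that pattern_fun_independent(1) by (simp add: T_val)
  have into: "T F \<in> \<A> h" if "F \<in> \<A> h" for F
  proof (rule linear_on_span_into[OF lin subspace_pattern_space])
    show "F \<in> fs.span (pattern_fun h ` \<G> h)"
      using that by (simp add: pattern_space_def)
  qed (auto simp: val antipode_fun_in)
  have S: "linear_on fscale (\<A> h) ?S" "\<And>F. F \<in> \<A> h \<Longrightarrow> ?S F \<in> \<A> h"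
    using lin into by (simp_all add: linear_on_restrict subspace_pattern_space)
  have S_val: "?S (pattern_fun h a) = antipode_fun a" if "a \<in> \<G> h" for a
    using that by (simp add: pattern_fun_in val)
  have unit_1: "pattern_fun h unit B = 1" if "B \<in> \<G> h" for B
    using that by (rule pattern_fun_unit_eq_1)
  \<comment> \<open>With the antipode in the first factor the inverse stands on the left, which is
    the situation of \<open>inversion_right\<close>.\<close>
  have left: "(\<Sum>(b, c)\<in>classes.decompositions a. ?S (pattern_fun h b) B * id (pattern_fun h c) B)
      = (if a = unit then 1 else 0)" if "a \<in> \<G> h" "B \<in> \<G> h" for a B
  proof -
    have "(\<Sum>(b, c)\<in>classes.decompositions a. ?S (pattern_fun h b) B * id (pattern_fun h c) B)
        = (\<Sum>(b, c)\<in>classes.decompositions a.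
            classes.inversion (\<lambda>b. - pattern_fun h b B) b * pattern_fun h c B)"
      using that by (intro sum.cong) (auto simp: S_val antipode_fun_def simp del: restrict_apply)
    then show ?thesis
      using classes.inversion_right[of a "\<lambda>b. pattern_fun h b B"] that unit_1 by simp
  qed
  have right: "(\<Sum>(b, c)\<in>classes.decompositions a. id (pattern_fun h b) B * ?S (pattern_fun h c) B)
      = (if a = unit then 1 else 0)" if "a \<in> \<G> h" "B \<in> \<G> h" for a B
  proof -
    have "(\<Sum>(b, c)\<in>classes.decompositions a. id (pattern_fun h b) B * ?S (pattern_fun h c) B)
        = (\<Sum>(b, c)\<in>classes.decompositions a.
            pattern_fun h b B * classes.inversion (\<lambda>b. - pattern_fun h b B) c)"
      using that by (intro sum.cong) (auto simp: S_val antipode_fun_def simp del: restrict_apply)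
    then show ?thesis
      using classes.inversion_left[of a "\<lambda>b. pattern_fun h b B"] that unit_1 by simp
  qed
  have "is_antipode ?A ?S"
    unfolding is_antipode_def pattern_bialgebra_simps
  proof (intro conjI ballI)
    show "?S \<in> linear_maps fscale fscale (\<A> h) (\<A> h)"
      by (intro restrict_in_linear_maps lin subspace_pattern_space into)
    show "mult_map ?A (tensor_map (\<A> h) (\<A> h) (\<A> h) (\<A> h) ?S id (pattern_comult h m F))
        = fscale (pattern_counit h e F) (\<lambda>B. if B \<in> \<G> h then 1 else 0)" if "F \<in> \<A> h" for F
      by (rule convolution_eqI[OF S linear_on_id _ left that]) simp_all
    show "mult_map ?A (tensor_map (\<A> h) (\<A> h) (\<A> h) (\<A> h) id ?S (pattern_comult h m F))
        = fscale (pattern_counit h e F) (\<lambda>B. if B \<in> \<G> h then 1 else 0)" if "F \<in> \<A> h" for F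
      by (rule convolution_eqI[OF linear_on_id _ S right that]) simp_all
  qed
  with S_val show ?thesis
    by (intro that)
qed

end

section \<open>Compatibility with the antipodes\<close>

locale connected_associative_presheaf_morphism =
  associative_presheaf_morphism h mh eh j mj ej f +
  h: connected_associative_presheaf h mh eh + j: connected_associative_presheaf j mj ej
  for h :: "'a presheaf" and mh eh and j :: "'b presheaf" and mj ej and f
begin

sublocale classes: graded_monoid_hom
  "\<G> h" h.mul h.unit class_size "\<G> j" j.mul j.unit class_size "class_map j f"
  by unfold_locales simp_all

text \<open>At a fixed class \<open>B\<close> this is \<open>inversion_hom\<close> for the negated
  pattern counts at \<open>B\<close> and at its image; \<open>pattern_fun_class_map\<close> is the
  required sum over fibres.\<close>

lemma pull_antipode_fun:
  "pull (j.antipode_fun a) = (\<Sum>b\<in>{b \<in> \<G> h. class_map j f b = a}. h.antipode_fun b)"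
proof
  fix B
  show "pull (j.antipode_fun a) B
      = (\<Sum>b\<in>{b \<in> \<G> h. class_map j f b = a}. h.antipode_fun b) B"
  proof (cases "B \<in> \<G> h")
    case True
    have "j.classes.inversion (\<lambda>b. - pattern_fun j b (class_map j f B)) a
        = (\<Sum>b\<in>{b \<in> \<G> h. class_map j f b = a}. h.classes.inversion (\<lambda>b. - pattern_fun h b B) b)"
      by (rule classes.inversion_hom) (simp add: pattern_fun_class_map True sum_negf)
    then show ?thesis
      using True by (simp add: pullback_def sum_fun_apply h.antipode_fun_def j.antipode_fun_def)
  qed (simp add: pullback_def sum_fun_apply h.antipode_fun_def)
qed

text \<open>For the explicit antipodes both composites are linear, and on a generator both equal the
  sum of \<open>h.antipode_fun\<close> over the fibre.\<close>

lemma hopf_morphism_pattern_map: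
  "hopf_morphism (pattern_bialgebra j mj ej) (pattern_bialgebra h mh eh) (pattern_map h j f)"
proof -
  let ?L = "pattern_map h j f"
  obtain S where S: "is_antipode (pattern_bialgebra j mj ej) S"
    and S_val: "\<And>a. a \<in> \<G> j \<Longrightarrow> S (pattern_fun j a) = j.antipode_fun a"
    using j.antipode_exists by metis
  obtain T where T: "is_antipode (pattern_bialgebra h mh eh) T"
    and T_val: "\<And>a. a \<in> \<G> h \<Longrightarrow> T (pattern_fun h a) = h.antipode_fun a"
    using h.antipode_exists by metis
  have lin_S: "linear_on fscale (\<A> j) S" and S_in: "\<And>F. F \<in> \<A> j \<Longrightarrow> S F \<in> \<A> j"
    and lin_T: "linear_on fscale (\<A> h) T"
    using S T by (auto simp: is_antipode_def linear_maps_def linear_on_def)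
  have lin_L: "linear_on fscale (\<A> j) ?L" and L_in: "\<And>F. F \<in> \<A> j \<Longrightarrow> ?L F \<in> \<A> h"
    using pattern_map_linear by (auto simp: linear_maps_def linear_on_def)
  have lin: "linear_on fscale (\<A> j) (\<lambda>F. ?L (S F))" "linear_on fscale (\<A> j) (\<lambda>F. T (?L F))"
    by (rule linear_on_compose[OF lin_S lin_L S_in], assumption)
      (rule linear_on_compose[OF lin_L lin_T L_in], assumption)
  have "?L (S (pattern_fun j a)) = T (?L (pattern_fun j a))" if a: "a \<in> \<G> j" for a
  proof -
    have "?L (S (pattern_fun j a)) = (\<Sum>b\<in>{b \<in> \<G> h. class_map j f b = a}. h.antipode_fun b)"
      by (simp only: S_val[OF a] pattern_map_eq restrict_apply' j.antipode_fun_in pull_antipode_fun)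
    also have "\<dots> = (\<Sum>b\<in>{b \<in> \<G> h. class_map j f b = a}. T (pattern_fun h b))"
      by (intro sum.cong) (auto simp: T_val)
    also have "\<dots> = T (\<Sum>b\<in>{b \<in> \<G> h. class_map j f b = a}. pattern_fun h b)"
      by (rule linear_on_sum[OF lin_T h.subspace_pattern_space, symmetric]) (simp add: h.pattern_fun_in)
    also have "\<dots> = T (?L (pattern_fun j a))"
      by (simp only: pattern_map_eq restrict_apply' j.pattern_fun_in[OF a] pull_pattern_fun[OF a])
    finally show ?thesis .
  qed
  then have "?L (S F) = T (?L F)" if "F \<in> \<A> j" for F
    using linear_on_span_eq[of fscale "pattern_fun j ` \<G> j" "\<lambda>F. ?L (S F)" "\<lambda>F. T (?L F)" F] lin that
    unfolding pattern_space_def[symmetric] by blast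
  with S T bialgebra_morphism_pattern_map show ?thesis
    unfolding hopf_morphism_def by auto
qed

end

theorem mainTheorem5:
  fixes h :: "'a presheaf" and j :: "'b presheaf" and f :: "nat set \<Rightarrow> 'a \<Rightarrow> 'b"
  assumes "combinatorial_presheaf h" and "combinatorial_presheaf j"
    and "presheaf_morphism h j f"
  shows "(\<exists>!L. is_pattern_map h j f L) \<and>
    algebra_morphism (pattern_algebra j) (pattern_algebra h) (pattern_map h j f) \<and>
    (\<forall>m\<^sub>h e\<^sub>h m\<^sub>j e\<^sub>j.
       associative_presheaf h m\<^sub>h e\<^sub>h \<and> associative_presheaf j m\<^sub>j e\<^sub>j \<and>
       associative_morphism m\<^sub>h e\<^sub>h m\<^sub>j e\<^sub>j h j f \<longrightarrow>
         bialgebra_morphism (pattern_bialgebra j m\<^sub>j e\<^sub>j) (pattern_bialgebra h m\<^sub>h e\<^sub>h) (pattern_map h j f) \<and>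
         (connected_presheaf h \<and> connected_presheaf j \<longrightarrow>
            hopf_morphism (pattern_bialgebra j m\<^sub>j e\<^sub>j) (pattern_bialgebra h m\<^sub>h e\<^sub>h) (pattern_map h j f)))"
proof -
  interpret combinatorial_presheaf_morphism h j f
    using assms by (rule combinatorial_presheaf_morphism.intro)
  show ?thesis
  proof (intro conjI allI impI; (elim conjE)?)
    show "\<exists>!L. is_pattern_map h j f L"
      by (simp only: is_pattern_map_iff) blast
    show "algebra_morphism (pattern_algebra j) (pattern_algebra h) (pattern_map h j f)"
      by (rule algebra_morphism_pattern_map)
    fix m\<^sub>h e\<^sub>h m\<^sub>j e\<^sub>j
    assume *: "associative_presheaf h m\<^sub>h e\<^sub>h" "associative_presheaf j m\<^sub>j e\<^sub>j"
      "associative_morphism m\<^sub>h e\<^sub>h m\<^sub>j e\<^sub>j h j f"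
    then interpret associative_presheaf_morphism h m\<^sub>h e\<^sub>h j m\<^sub>j e\<^sub>j f
      by (intro associative_presheaf_morphism.intro associative_presheaf_morphism_axioms.intro
          combinatorial_presheaf_morphism_axioms) (auto simp: associative_morphism_def)
    show "bialgebra_morphism (pattern_bialgebra j m\<^sub>j e\<^sub>j) (pattern_bialgebra h m\<^sub>h e\<^sub>h) (pattern_map h j f)"
      by (rule bialgebra_morphism_pattern_map)
    assume "connected_presheaf h" "connected_presheaf j"
    then interpret connected_associative_presheaf_morphism h m\<^sub>h e\<^sub>h j m\<^sub>j e\<^sub>j f
      by unfold_locales
    show "hopf_morphism (pattern_bialgebra j m\<^sub>j e\<^sub>j) (pattern_bialgebra h m\<^sub>h e\<^sub>h) (pattern_map h j f)"
      by (rule hopf_morphism_pattern_map)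
  qed
qed

end
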